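(* Let $c>0$ be real and let $f:\mathbb{T}^2\to\mathbb{T}^2$ be the skew-product defined (for $x\neq 1/2$) by $$f(x,y)=\left(2x-\lfloor 2x\rfloor,\ y+\frac{c}{|x-1/2|}-\left\lfloor y+\frac{c}{|x-1/2|}\right\rfloor\right).$$ Then $f$ preserves the Lebesgue measure $m$ on the torus $\mathbb{T}^2$, and, if $c>1/4$, $f$ is mixing with respect to $m$.
   Context: $\mathbb{T}^2$ is the two-dimensional torus, obtained from $[0,1]\times[0,1]$ by identifying opposite sides; $\lfloor t\rfloor$ is the greatest integer less than or equal to $t$. The map $f$ is defined off the circle $\{x=1/2\}$, which has zero Lebesgue measure. A map $f$ with an invariant probability measure $\mu$ on a $\sigma$-algebra $\mathcal{A}$ is mixing with respect to $\mu$ if for all $A,B\in\mathcal{A}$ one has $\lim_{n\to\infty}\mu(f^{-n}(A)\cap B)=\mu(A)\mu(B)$. *)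

theory Defs
  imports "HOL-Probability.Probability"
begin

text \<open>
  The torus is modelled by the fundamental domain \<open>[0,1) \<times> [0,1)\<close>. Identifying opposite sides of
  the closed square amounts to equality modulo \<open>\<int>\<^sup>2\<close>, and every class has exactly one
  representative here (lemma \<open>torus_representative\<close>).
\<close>

definition torus :: "(real \<times> real) set" where
  "torus = {0..<1} \<times> {0..<1}"

text \<open>The sets of this measure are all Lebesgue sets, not only the Borel ones.\<close>

abbreviation torus_lebesgue :: "(real \<times> real) measure" where
  "torus_lebesgue \<equiv> lebesgue_on torus"

definition measure_preserving :: "'a measure \<Rightarrow> ('a \<Rightarrow> 'a) \<Rightarrow> bool" where
  "measure_preserving M f \<longleftrightarrow>
     f \<in> measurable M M \<and>
     (\<forall>A\<in>sets M. emeasure M (f -` A \<inter> space M) = emeasure M A)"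

definition mixing :: "'a measure \<Rightarrow> ('a \<Rightarrow> 'a) \<Rightarrow> bool" where
  "mixing M f \<longleftrightarrow>
     prob_space M \<and> measure_preserving M f \<and>
     (\<forall>A\<in>sets M. \<forall>B\<in>sets M.
        (\<lambda>n. measure M ((f ^^ n) -` A \<inter> B)) \<longlonglongrightarrow> measure M A * measure M B)"

lemma torus_representative:
  assumes "p \<in> {0..1} \<times> {0..1}"
  shows "\<exists>!q. q \<in> torus \<and> fst p - fst q \<in> \<int> \<and> snd p - snd q \<in> \<int>"
proof (rule ex1I)
  show "(frac (fst p), frac (snd p)) \<in> torus \<and>
      fst p - fst (frac (fst p), frac (snd p)) \<in> \<int> \<and>
      snd p - snd (frac (fst p), frac (snd p)) \<in> \<int>"
    by (simp add: torus_def frac_lt_1) (simp add: frac_def)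
next
  fix q assume "q \<in> torus \<and> fst p - fst q \<in> \<int> \<and> snd p - snd q \<in> \<int>"
  then show "q = (frac (fst p), frac (snd p))"
    by (auto simp: torus_def frac_unique_iff prod_eq_iff intro!: frac_unique_iff[THEN iffD2, symmetric])
qed

end

theory Submission
  imports Defs
begin

text \<open>
  Let \<open>T\<close> be the doubling map and \<open>\<phi>(x) = c / |x - 1/2|\<close>. Expanding in characters of the second
  coordinate reduces mixing to the decay of
  \<open>\<integral> 1\<^sub>X(T\<^sup>n x) exp (i k S\<^sub>n(x)) 1\<^sub>I(x) dx = \<integral>\<^sub>X U\<^sub>n\<close> for \<open>k \<noteq> 0\<close>, where \<open>S\<^sub>n\<close> is the
  Birkhoff sum of \<open>\<phi>\<close> and \<open>U\<^sub>n\<close> is the \<open>n\<close>-th iterate of \<open>1\<^sub>I\<close> under the transfer operator of \<open>T\<close>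
  twisted by \<open>exp (i k \<phi>)\<close>.

  The \<open>L\<^sup>2\<close> norms of the \<open>U\<^sub>n\<close> decrease and the decrements control the differences between the two
  branches, so for almost every \<open>y\<close> the summands over the preimages of \<open>y\<close> are asymptotically
  equal; in particular \<open>|U\<^sub>n|\<close> is asymptotically equal at any two points with a common forward
  image. The \<open>U\<^sub>n\<close> are also equicontinuous on compact subsets of the open interval, up to \<open>2\<^sup>-\<^sup>n\<close>.
  The points \<open>1/2 + t\<close> and \<open>3/4 + t\<close> have the same image under \<open>T\<^sup>2\<close>, but the ratio of their phases
  is \<open>exp (i k c / (2t))\<close> times a continuous function of \<open>t\<close>. It oscillates as \<open>t\<close> tends to 0, which
  forces \<open>U\<^sub>n(1/2)\<close> to tend to 0. Since every \<open>y\<close> has iterated preimages arbitrarily close to \<open>1/2\<close>,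
  \<open>U\<^sub>n\<close> tends to 0 almost everywhere.
\<close>

section \<open>Lebesgue measure on the unit interval and the doubling map\<close>

definition unit_lebesgue :: "real measure" where
  "unit_lebesgue = restrict_space lborel {0..<1}"

lemma space_unit_lebesgue [simp]: "space unit_lebesgue = {0..<1}"
  by (simp add: unit_lebesgue_def space_restrict_space)

lemma sets_unit_lebesgue [measurable_cong]: "sets unit_lebesgue = sets (restrict_space borel {0..<1})"
  unfolding unit_lebesgue_def by (intro sets_restrict_space_cong) simp

lemma sets_unit_lebesgue_iff: "A \<in> sets unit_lebesgue \<longleftrightarrow> A \<in> sets borel \<and> A \<subseteq> {0..<1}"
  by (simp add: sets_unit_lebesgue sets_restrict_space_iff conj_commute)

lemma emeasure_unit_lebesgue:
  "A \<in> sets unit_lebesgue \<Longrightarrow> emeasure unit_lebesgue A = emeasure lborel A"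
  unfolding unit_lebesgue_def
  by (intro emeasure_restrict_space) (auto simp: sets_restrict_space)

interpretation unit_lebesgue: prob_space unit_lebesgue
  by (intro prob_spaceI) (simp add: emeasure_unit_lebesgue sets_unit_lebesgue_iff)

lemma borel_measurable_unit_lebesgue:
  "f \<in> borel_measurable borel \<Longrightarrow> f \<in> borel_measurable unit_lebesgue"
  by (simp add: unit_lebesgue_def measurable_restrict_space1)

lemma measurable_into_unit_lebesgue:
  assumes "f \<in> borel_measurable M" "\<And>x. x \<in> space M \<Longrightarrow> f x \<in> {0..<1}"
  shows "f \<in> measurable M unit_lebesgue"
  using assms by (subst measurable_cong_sets[OF refl sets_unit_lebesgue])
    (auto intro!: measurable_restrict_space2)

lemma AE_unit_lebesgueI: "(AE x in lborel. x \<in> {0..<1} \<longrightarrow> P x) \<Longrightarrow> AE x in unit_lebesgue. P x"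
  unfolding unit_lebesgue_def by (subst AE_restrict_space_iff) auto

lemma integral_unit_lebesgue:
  fixes f :: "real \<Rightarrow> 'a::{banach, second_countable_topology}"
  shows "integral\<^sup>L unit_lebesgue f = (\<integral>x. indicator {0..<1} x *\<^sub>R f x \<partial>lborel)"
  by (simp add: unit_lebesgue_def integral_restrict_space)

lemma integrable_unit_lebesgue:
  fixes f :: "real \<Rightarrow> 'a::{banach, second_countable_topology}"
  shows "integrable unit_lebesgue f \<longleftrightarrow> integrable lborel (\<lambda>x. indicator {0..<1} x *\<^sub>R f x)"
  by (simp add: unit_lebesgue_def integrable_restrict_space)

text \<open>The inverse branches map the unit interval affinely onto \<open>[0, 1/2)\<close> and
  \<open>[1/2, 1)\<close>; the Jacobian gives the factor 1/2.\<close>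

lemma
  fixes f :: "real \<Rightarrow> 'a::{banach, second_countable_topology}"
  assumes f: "integrable unit_lebesgue f"
  shows integrable_branch_0: "integrable unit_lebesgue (\<lambda>y. f (y / 2))"
    and integrable_branch_1: "integrable unit_lebesgue (\<lambda>y. f ((y + 1) / 2))"
    and integral_branches: "integral\<^sup>L unit_lebesgue f =
      (1/2) *\<^sub>R ((\<integral>y. f (y / 2) \<partial>unit_lebesgue) + (\<integral>y. f ((y + 1) / 2) \<partial>unit_lebesgue))"
proof -
  define F where "F = (\<lambda>x. indicator {0..<1::real} x *\<^sub>R f x)"
  define F0 where "F0 = (\<lambda>x. indicator {0..<1/2::real} x *\<^sub>R F x)"
  define F1 where "F1 = (\<lambda>x. indicator {1/2..<1::real} x *\<^sub>R F x)"
  have F: "integrable lborel F"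
    using f by (simp add: F_def integrable_unit_lebesgue)
  then have F0: "integrable lborel F0" and F1: "integrable lborel F1"
    unfolding F0_def F1_def by (auto intro!: integrable_mult_indicator)
  have eq0: "(\<lambda>x. F0 (0 + (1/2) * x)) = (\<lambda>y. indicator {0..<1} y *\<^sub>R f (y / 2))"
    by (auto simp: F0_def F_def fun_eq_iff indicator_def)
  have eq1: "(\<lambda>x. F1 (1/2 + (1/2) * x)) = (\<lambda>y. indicator {0..<1} y *\<^sub>R f ((y + 1) / 2))"
    by (auto simp: F1_def F_def fun_eq_iff indicator_def field_simps)
  show "integrable unit_lebesgue (\<lambda>y. f (y / 2))"
    using lborel_integrable_real_affine[OF F0, of "1/2" 0]
    unfolding eq0 integrable_unit_lebesgue by simp
  show "integrable unit_lebesgue (\<lambda>y. f ((y + 1) / 2))"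
    using lborel_integrable_real_affine[OF F1, of "1/2" "1/2"]
    unfolding eq1 integrable_unit_lebesgue by simp
  have "integral\<^sup>L unit_lebesgue f = integral\<^sup>L lborel (\<lambda>x. F0 x + F1 x)"
    unfolding integral_unit_lebesgue
    by (intro Bochner_Integration.integral_cong) (auto simp: F0_def F1_def F_def indicator_def)
  also have "\<dots> = integral\<^sup>L lborel F0 + integral\<^sup>L lborel F1"
    using F0 F1 by simp
  also have "integral\<^sup>L lborel F0 = (1/2) *\<^sub>R (\<integral>y. f (y / 2) \<partial>unit_lebesgue)"
    using lborel_integral_real_affine[of "1/2" F0 0]
    unfolding eq0 integral_unit_lebesgue by simp
  also have "integral\<^sup>L lborel F1 = (1/2) *\<^sub>R (\<integral>y. f ((y + 1) / 2) \<partial>unit_lebesgue)"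
    using lborel_integral_real_affine[of "1/2" F1 "1/2"]
    unfolding eq1 integral_unit_lebesgue by simp
  finally show "integral\<^sup>L unit_lebesgue f =
      (1/2) *\<^sub>R ((\<integral>y. f (y / 2) \<partial>unit_lebesgue) + (\<integral>y. f ((y + 1) / 2) \<partial>unit_lebesgue))"
    by (simp add: scaleR_add_right)
qed

lemma frac_borel_measurable [measurable]: "(frac :: real \<Rightarrow> real) \<in> borel_measurable borel"
  unfolding frac_def[abs_def] by measurable

text \<open>A rotation cuts the interval at \<open>1 - frac s\<close> and translates the two pieces;
  Lebesgue measure is translation invariant.\<close>

lemma integral_rotate:
  fixes f :: "real \<Rightarrow> 'a::{banach, second_countable_topology}"
  assumes f: "integrable unit_lebesgue f"
  shows "(\<integral>y. f (frac (y + s)) \<partial>unit_lebesgue) = integral\<^sup>L unit_lebesgue f"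
proof -
  define r where "r = frac s"
  have r: "0 \<le> r" "r < 1"
    by (auto simp: r_def frac_lt_1)
  have fr: "frac (y + s) = (if y < 1 - r then y + r else y + r - 1)" if "0 \<le> y" "y < 1" for y
    using that r unfolding r_def
    by (simp add: frac_add frac_eq[THEN iffD2])
  define F where "F = (\<lambda>x. indicator {0..<1::real} x *\<^sub>R f x)"
  define F0 where "F0 = (\<lambda>x. indicator {r..<1::real} x *\<^sub>R F x)"
  define F1 where "F1 = (\<lambda>x. indicator {0..<r::real} x *\<^sub>R F x)"
  have F: "integrable lborel F"
    using f by (simp add: F_def integrable_unit_lebesgue)
  then have F0: "integrable lborel F0" and F1: "integrable lborel F1"
    unfolding F0_def F1_def by (auto intro!: integrable_mult_indicator)
  have eq: "indicator {0..<1} y *\<^sub>R f (frac (y + s)) = F0 (r + 1 * y) + F1 (r - 1 + 1 * y)" for y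
    using r fr[of y] by (auto simp: F0_def F1_def F_def indicator_def algebra_simps)
  have I0: "integrable lborel (\<lambda>y. F0 (r + 1 * y))" and I1: "integrable lborel (\<lambda>y. F1 (r - 1 + 1 * y))"
    using lborel_integrable_real_affine[OF F0, of 1 r] lborel_integrable_real_affine[OF F1, of 1 "r - 1"]
    by auto
  have "(\<integral>y. f (frac (y + s)) \<partial>unit_lebesgue) =
      integral\<^sup>L lborel (\<lambda>y. F0 (r + 1 * y)) + integral\<^sup>L lborel (\<lambda>y. F1 (r - 1 + 1 * y))"
    unfolding integral_unit_lebesgue eq using I0 I1 by (rule Bochner_Integration.integral_add)
  also have "\<dots> = integral\<^sup>L lborel F0 + integral\<^sup>L lborel F1"
    using lborel_integral_real_affine[of 1 F0 r] lborel_integral_real_affine[of 1 F1 "r - 1"] by simp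
  also have "\<dots> = integral\<^sup>L lborel (\<lambda>x. F0 x + F1 x)"
    using F0 F1 by simp
  also have "\<dots> = integral\<^sup>L unit_lebesgue f"
    unfolding integral_unit_lebesgue using r
    by (intro Bochner_Integration.integral_cong) (auto simp: F0_def F1_def F_def indicator_def)
  finally show "(\<integral>y. f (frac (y + s)) \<partial>unit_lebesgue) = integral\<^sup>L unit_lebesgue f" .
qed

lemma AE_branches:
  assumes "AE x in unit_lebesgue. P x"
  shows "AE y in unit_lebesgue. P (y / 2) \<and> P ((y + 1) / 2)"
proof -
  obtain N where N: "N \<in> null_sets unit_lebesgue" "{x \<in> {0..<1}. \<not> P x} \<subseteq> N"
    using assms by (auto simp: eventually_ae_filter)
  have Nb [measurable]: "N \<in> sets borel" and N0: "emeasure lborel N = 0"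
    using N(1) by (auto simp: null_sets_def sets_unit_lebesgue_iff emeasure_unit_lebesgue)
  have "AE x in lborel. x \<notin> N"
    using N0 by (intro AE_not_in) (auto simp: null_sets_def)
  from AE_borel_affine[OF _ _ this, of "1/2" 0] AE_borel_affine[OF _ _ this, of "1/2" "1/2"]
  have "AE y in lborel. y / 2 \<notin> N" "AE y in lborel. (y + 1) / 2 \<notin> N"
    by (auto simp: field_simps)
  moreover have P: "P x" if "x \<notin> N" "x \<in> {0..<1}" for x
    using that N(2) by auto
  ultimately have "AE y in lborel. y \<in> {0..<1} \<longrightarrow> P (y / 2) \<and> P ((y + 1) / 2)"
    by eventually_elim (auto intro!: P)
  then show ?thesis
    by (rule AE_unit_lebesgueI)
qed

definition doubling :: "real \<Rightarrow> real" where
  "doubling x = frac (2 * x)"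

lemma doubling_range: "doubling x \<in> {0..<1}"
  by (simp add: doubling_def frac_lt_1)

lemma doubling_branches:
  assumes "y \<in> {0..<1}"
  shows "doubling (y / 2) = y" "doubling ((y + 1) / 2) = y"
proof -
  show "doubling (y / 2) = y"
    using assms by (simp add: doubling_def frac_eq)
  have "doubling ((y + 1) / 2) = frac (y + 1)" unfolding doubling_def by (rule arg_cong[where f = frac]) simp
  then show "doubling ((y + 1) / 2) = y"
    using assms by (simp add: frac_eq frac_1_eq)
qed

lemma doubling_borel_measurable [measurable]: "doubling \<in> borel_measurable borel"
  unfolding doubling_def[abs_def] by measurable

lemma doubling_funpow_borel_measurable [measurable]: "doubling ^^ n \<in> borel_measurable borel"
proof (induction n)
  case 0
  show ?case by (simp add: id_def)
next
  case (Suc n)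
  have "(\<lambda>x. doubling ((doubling ^^ n) x)) \<in> borel_measurable borel"
    using Suc doubling_borel_measurable by (rule measurable_compose)
  then show ?case
    by (simp add: comp_def)
qed

section \<open>The twisted transfer operator\<close>

text \<open>Iterates of the transfer operator of the doubling map twisted by \<open>q\<close>:
  \<open>y / 2\<close> and \<open>(y + 1) / 2\<close> are the preimages of \<open>y\<close>, and
  each inverse branch has derivative 1/2.\<close>

fun transfer :: "(real \<Rightarrow> complex) \<Rightarrow> (real \<Rightarrow> complex) \<Rightarrow> nat \<Rightarrow> real \<Rightarrow> complex" where
  "transfer q g 0 y = g y"
| "transfer q g (Suc n) y =
    (q (y / 2) * transfer q g n (y / 2) + q ((y + 1) / 2) * transfer q g n ((y + 1) / 2)) / 2"

lemmas transfer_Suc = transfer.simps(2)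
declare transfer.simps(2) [simp del]

lemma transfer_0 [simp]: "transfer q g 0 = g"
  by (simp add: fun_eq_iff)

lemma transfer_borel_measurable [measurable]:
  assumes [measurable]: "q \<in> borel_measurable borel" "g \<in> borel_measurable borel"
  shows "transfer q g n \<in> borel_measurable borel"
proof (induction n)
  case (Suc n)
  note [measurable] = this
  show ?case
    by (simp add: transfer_Suc[abs_def])
qed simp

lemma norm_transfer_le:
  assumes "\<And>x. norm (q x) \<le> 1" "\<And>x. norm (g x) \<le> 1"
  shows "norm (transfer q g n y) \<le> 1"
proof (induction n arbitrary: y)
  case (Suc n)
  have *: "norm (q x * transfer q g n x) \<le> 1" for x
    using mult_mono[OF assms(1)[of x] Suc[of x]] by (simp add: norm_mult)
  show ?case
    using norm_triangle_ineq[of "q (y / 2) * transfer q g n (y / 2)"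
        "q ((y + 1) / 2) * transfer q g n ((y + 1) / 2)"] *[of "y / 2"] *[of "(y + 1) / 2"]
    by (simp add: norm_divide transfer_Suc)
qed (simp add: assms)

lemma integrable_unit_lebesgue_bounded:
  fixes f :: "real \<Rightarrow> 'a::{banach, second_countable_topology}"
  assumes "f \<in> borel_measurable borel" "\<And>x. norm (f x) \<le> B"
  shows "integrable unit_lebesgue f"
  using assms by (intro unit_lebesgue.integrable_const_bound[where B = B])
    (auto intro: borel_measurable_unit_lebesgue)

text \<open>Duality: for the bilinear pairing, composing with \<open>doubling\<close> and
  multiplying by \<open>q\<close> is the transpose of the twisted transfer operator.\<close>

lemma integral_doubling_transfer:
  assumes [measurable]: "q \<in> borel_measurable borel" "g \<in> borel_measurable borel" "h \<in> borel_measurable borel"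
    and q: "\<And>x. norm (q x) \<le> 1" and g: "\<And>x. norm (g x) \<le> 1" and h: "\<And>x. norm (h x) \<le> B"
  shows "(\<integral>x. h ((doubling ^^ n) x) * (\<Prod>j<n. q ((doubling ^^ j) x)) * g x \<partial>unit_lebesgue)
       = (\<integral>x. h x * transfer q g n x \<partial>unit_lebesgue)"
  using assms(3) h
proof (induction n arbitrary: h B)
  case (Suc n)
  note [measurable] = Suc.prems(1)
  have B: "0 \<le> B"
    using Suc.prems(2)[of 0] norm_ge_zero order_trans by blast
  have U: "norm (transfer q g n x) \<le> 1" for x
    using q g by (rule norm_transfer_le)
  \<comment> \<open>The factor with index \<open>n\<close> is absorbed into the test function; hence
    the induction runs over all bounded \<open>h\<close>.\<close>
  define k where "k = (\<lambda>x. h (doubling x) * q x)"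
  have [measurable]: "k \<in> borel_measurable borel"
    unfolding k_def by measurable
  have k: "norm (k x) \<le> B" for x
    using mult_mono[OF Suc.prems(2)[of "doubling x"] q[of x]] B by (simp add: k_def norm_mult)
  have kU: "integrable unit_lebesgue (\<lambda>x. k x * transfer q g n x)"
  proof (rule integrable_unit_lebesgue_bounded[where B = B])
    show "norm (k x * transfer q g n x) \<le> B" for x
      using mult_mono[OF k[of x] U[of x]] B by (simp add: norm_mult)
  qed measurable
  have "(\<integral>x. h ((doubling ^^ Suc n) x) * (\<Prod>j<Suc n. q ((doubling ^^ j) x)) * g x \<partial>unit_lebesgue)
      = (\<integral>x. k ((doubling ^^ n) x) * (\<Prod>j<n. q ((doubling ^^ j) x)) * g x \<partial>unit_lebesgue)"
    by (intro Bochner_Integration.integral_cong) (auto simp: k_def)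
  also have "\<dots> = (\<integral>x. k x * transfer q g n x \<partial>unit_lebesgue)"
    by (rule Suc.IH[OF _ k]) measurable
  also have "\<dots> = (1/2) *\<^sub>R ((\<integral>y. k (y / 2) * transfer q g n (y / 2) \<partial>unit_lebesgue)
      + (\<integral>y. k ((y + 1) / 2) * transfer q g n ((y + 1) / 2) \<partial>unit_lebesgue))"
    by (rule integral_branches[OF kU])
  also have "\<dots> = (1/2) *\<^sub>R (\<integral>y. k (y / 2) * transfer q g n (y / 2)
      + k ((y + 1) / 2) * transfer q g n ((y + 1) / 2) \<partial>unit_lebesgue)"
    using integrable_branch_0[OF kU] integrable_branch_1[OF kU] by simp
  also have "\<dots> = (\<integral>y. (1/2) *\<^sub>R (k (y / 2) * transfer q g n (y / 2)
      + k ((y + 1) / 2) * transfer q g n ((y + 1) / 2)) \<partial>unit_lebesgue)"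
    by (rule integral_scaleR_right[symmetric])
  also have "\<dots> = (\<integral>y. h y * transfer q g (Suc n) y \<partial>unit_lebesgue)"
    by (intro Bochner_Integration.integral_cong)
      (auto simp: k_def doubling_branches scaleR_conv_of_real transfer_Suc field_simps)
  finally show ?case .
qed simp

section \<open>Mean-square comparison of the two branches, and regular points\<close>

lemma norm_average_eq:
  fixes u v :: complex
  shows "(norm (u - v))\<^sup>2 / 4 = ((norm u)\<^sup>2 + (norm v)\<^sup>2) / 2 - (norm ((u + v) / 2))\<^sup>2"
proof -
  have "(norm (u - v))\<^sup>2 + (norm (u + v))\<^sup>2 = 2 * (norm u)\<^sup>2 + 2 * (norm v)\<^sup>2"
    by (simp only: cmod_power2 minus_complex.sel plus_complex.sel) (simp add: power2_eq_square algebra_simps)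
  then show ?thesis
    by (simp add: norm_divide power_divide field_simps)
qed

text \<open>The \<open>L\<^sup>2\<close> norm of the iterates decreases, and each decrement is the mean square
  difference of the two summands of the transfer operator.\<close>

lemma transfer_branches_tendsto:
  assumes [measurable]: "q \<in> borel_measurable borel" "g \<in> borel_measurable borel"
    and q: "\<And>x. norm (q x) = 1" and g: "\<And>x. norm (g x) \<le> 1"
  shows "AE y in unit_lebesgue. (\<lambda>n. q (y / 2) * transfer q g n (y / 2)
           - q ((y + 1) / 2) * transfer q g n ((y + 1) / 2)) \<longlonglongrightarrow> 0"
proof -
  define U where "U = transfer q g"
  have [measurable]: "U n \<in> borel_measurable borel" for n
    unfolding U_def by measurable
  have U: "norm (U n x) \<le> 1" for n x
    unfolding U_def by (rule norm_transfer_le) (auto simp: q g)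
  define d where "d = (\<lambda>n y. (norm (q (y / 2) * U n (y / 2) - q ((y + 1) / 2) * U n ((y + 1) / 2)))\<^sup>2 / 4)"
  have [measurable]: "d n \<in> borel_measurable borel" for n
    unfolding d_def by measurable
  define e where "e = (\<lambda>n. \<integral>y. (norm (U n y))\<^sup>2 \<partial>unit_lebesgue)"
  have I: "integrable unit_lebesgue (\<lambda>y. (norm (U n y))\<^sup>2)" for n
    by (rule integrable_unit_lebesgue_bounded[where B = 1]) (auto simp: U power_le_one)
  have d_eq: "d n y = ((norm (U n (y / 2)))\<^sup>2 + (norm (U n ((y + 1) / 2)))\<^sup>2) / 2 - (norm (U (Suc n) y))\<^sup>2" for n y
    unfolding d_def norm_average_eq by (simp add: norm_mult q U_def transfer_Suc)
  have d_int: "integrable unit_lebesgue (d n)" and d_integral: "integral\<^sup>L unit_lebesgue (d n) = e n - e (Suc n)" for n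
    unfolding d_eq e_def using integrable_branch_0[OF I[of n]] integrable_branch_1[OF I[of n]] I[of "Suc n"]
      integral_branches[OF I[of n]]
    by (auto simp: add_divide_distrib)
  have "(\<Sum>n<N. integral\<^sup>L unit_lebesgue (d n)) \<le> 1" for N
  proof -
    have "(\<Sum>n<N. integral\<^sup>L unit_lebesgue (d n)) = e 0 - e N"
      unfolding d_integral by (induction N) auto
    also have "e 0 \<le> 1"
      unfolding e_def by (rule unit_lebesgue.integral_le_const[OF I]) (auto simp: U power_le_one)
    moreover have "0 \<le> e N"
      unfolding e_def by simp
    ultimately show ?thesis by simp
  qed
  moreover have d_nonneg: "0 \<le> d n y" for n y
    by (simp add: d_def)
  ultimately have "(\<Sum>n. ennreal (integral\<^sup>L unit_lebesgue (d n))) \<le> 1"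
    by (intro suminf_le_const) (auto simp: sum_ennreal)
  \<comment> \<open>The sum of the \<open>d n\<close> has finite integral, so for almost every
    \<open>y\<close> the series converges and its terms tend to 0.\<close>
  then have "(\<integral>\<^sup>+y. (\<Sum>n. ennreal (d n y)) \<partial>unit_lebesgue) \<le> 1"
    by (subst nn_integral_suminf)
      (auto simp: nn_integral_eq_integral d_int d_nonneg borel_measurable_unit_lebesgue)
  then have "(\<integral>\<^sup>+y. (\<Sum>n. ennreal (d n y)) \<partial>unit_lebesgue) \<noteq> \<infinity>"
    by (auto simp: top_unique)
  then have "AE y in unit_lebesgue. (\<Sum>n. ennreal (d n y)) \<noteq> \<infinity>"
    by (intro nn_integral_PInf_AE) (auto simp: borel_measurable_unit_lebesgue)
  then show ?thesis
  proof eventually_elim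
    case (elim y)
    then have "summable (\<lambda>n. d n y)"
      by (intro summable_suminf_not_top) (auto simp: d_nonneg)
    then have "(\<lambda>n. sqrt (4 * d n y)) \<longlonglongrightarrow> sqrt (4 * 0)"
      by (intro tendsto_intros summable_LIMSEQ_zero)
    then show ?case
      by (simp add: d_def U_def tendsto_norm_zero_iff)
  qed
qed

text \<open>At a regular point the asymptotic equality of the two summands holds along the whole
  backward tree of the doubling map.\<close>

definition regular :: "(real \<Rightarrow> complex) \<Rightarrow> (real \<Rightarrow> complex) \<Rightarrow> real \<Rightarrow> bool" where
  "regular q g y \<longleftrightarrow> (\<forall>j. \<forall>a<2^j. let z = (real a + y) / 2^j in
     (\<lambda>n. q (z / 2) * transfer q g n (z / 2) - q ((z + 1) / 2) * transfer q g n ((z + 1) / 2)) \<longlonglongrightarrow> 0)"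

text \<open>The points \<open>(a + y) / 2^j\<close> with \<open>a < 2^j\<close> are the preimages of
  \<open>y\<close> under the \<open>j\<close>-th iterate; each level pulls a null set back along two
  affine maps.\<close>

lemma AE_backward_tree:
  assumes "AE x in unit_lebesgue. P x"
  shows "AE y in unit_lebesgue. \<forall>a<2^j. P ((real a + y) / 2^j)"
proof (induction j)
  case (Suc j)
  from AE_branches[OF this] show ?case
  proof eventually_elim
    case (elim y)
    show ?case
    proof safe
      fix a :: nat assume "a < 2^Suc j"
      then have a: "a div 2 < 2^j" by auto
      \<comment> \<open>The lowest binary digit of \<open>a\<close> selects the branch applied first
        to \<open>y\<close>, and \<open>a div 2\<close> indexes the remaining \<open>j\<close>
        branches.\<close>
      have "real a = 2 * real (a div 2) + real (a mod 2)"
        by (metis mult_div_mod_eq of_nat_add of_nat_mult of_nat_numeral)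
      moreover have "a mod 2 = 0 \<or> a mod 2 = 1" by auto
      ultimately have "(real a + y) / 2^Suc j = (real (a div 2) + y / 2) / 2^j \<or>
          (real a + y) / 2^Suc j = (real (a div 2) + (y + 1) / 2) / 2^j"
        by (auto simp: field_simps)
      then show "P ((real a + y) / 2^Suc j)"
        using elim a by (auto simp del: power_Suc)
    qed
  qed
qed (use assms in simp)

lemma AE_regular:
  assumes "q \<in> borel_measurable borel" "g \<in> borel_measurable borel"
    and "\<And>x. norm (q x) = 1" and "\<And>x. norm (g x) \<le> 1"
  shows "AE y in unit_lebesgue. regular q g y"
proof -
  define P where "P = (\<lambda>z. (\<lambda>n. q (z / 2) * transfer q g n (z / 2)
      - q ((z + 1) / 2) * transfer q g n ((z + 1) / 2)) \<longlonglongrightarrow> 0)"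
  have "AE z in unit_lebesgue. P z"
    unfolding P_def using assms by (rule transfer_branches_tendsto)
  then have "AE y in unit_lebesgue. \<forall>j. \<forall>a<2^j. P ((real a + y) / 2^j)"
    by (subst AE_all_countable) (intro allI AE_backward_tree)
  then show ?thesis
    by (simp add: regular_def Let_def P_def)
qed

text \<open>The backward tree of a preimage is a subtree: index \<open>a\<close> at level
  \<open>j\<close> becomes \<open>2 * a + b\<close> one level deeper.\<close>

lemma regular_branch:
  assumes "regular q g y" "b < 2"
  shows "regular q g ((y + real b) / 2)"
  unfolding regular_def
proof (intro allI impI)
  fix j a :: nat assume "a < 2^j"
  then have less: "2 * a + b < 2^Suc j" using assms(2) by auto
  have eq: "(real (2 * a + b) + y) / 2^Suc j = (real a + (y + real b) / 2) / 2^j"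
    by (simp add: field_simps)
  show "let z = (real a + (y + real b) / 2) / 2^j in
     (\<lambda>n. q (z / 2) * transfer q g n (z / 2) - q ((z + 1) / 2) * transfer q g n ((z + 1) / 2)) \<longlonglongrightarrow> 0"
    using assms(1)[unfolded regular_def, THEN spec, THEN spec, THEN mp, OF less] unfolding eq .
qed

text \<open>A new iterate is the mean of its two summands, so it differs from either by half of
  their difference, which tends to 0 at the root of the tree.\<close>

lemma regular_step:
  assumes "regular q g y" "b < 2"
  shows "(\<lambda>n. transfer q g (Suc n) y - q ((y + real b) / 2) * transfer q g n ((y + real b) / 2)) \<longlonglongrightarrow> 0"
proof -
  have *: "(\<lambda>n. q (y / 2) * transfer q g n (y / 2) - q ((y + 1) / 2) * transfer q g n ((y + 1) / 2)) \<longlonglongrightarrow> 0"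
    using assms(1)[unfolded regular_def Let_def, rule_format, of 0 0] by simp
  consider "b = 0" | "b = 1" using assms(2) by linarith
  then have "(\<lambda>n. transfer q g (Suc n) y - q ((y + real b) / 2) * transfer q g n ((y + real b) / 2))
     = (\<lambda>n. (real b - 1/2) * (q (y / 2) * transfer q g n (y / 2)
           - q ((y + 1) / 2) * transfer q g n ((y + 1) / 2)))"
    by cases (simp_all add: fun_eq_iff transfer_Suc field_simps)
  then show ?thesis
    using tendsto_mult_left[OF *, of "complex_of_real (real b - 1/2)"] by simp
qed

text \<open>Following the binary digits of \<open>a\<close> takes one application of
  \<open>regular_step\<close> per level. Passing to norms discards the phases picked up on the
  way.\<close>

lemma regular_norm_tendsto:
  assumes q: "\<And>x. norm (q x) = 1"
  shows "regular q g y \<Longrightarrow> a < 2^j \<Longrightarrow>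
    (\<lambda>n. norm (transfer q g (n + j) y) - norm (transfer q g n ((real a + y) / 2^j))) \<longlonglongrightarrow> 0"
proof (induction j arbitrary: y a)
  case (Suc j)
  define b where "b = a mod 2"
  have b: "b < 2" by (simp add: b_def)
  have a: "a div 2 < 2^j" using Suc.prems(2) by auto
  have "real a = 2 * real (a div 2) + real b"
    unfolding b_def by (metis mult_div_mod_eq of_nat_add of_nat_mult of_nat_numeral)
  then have eq: "(real a + y) / 2^Suc j = (real (a div 2) + (y + real b) / 2) / 2^j"
    by (simp add: field_simps)
  have rest: "(\<lambda>n. norm (transfer q g (n + j) ((y + real b) / 2)) - norm (transfer q g n ((real a + y) / 2^Suc j))) \<longlonglongrightarrow> 0"
    unfolding eq by (rule Suc.IH[OF regular_branch[OF Suc.prems(1) b] a])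
  have step: "(\<lambda>n. norm (transfer q g (Suc n) y) - norm (transfer q g n ((y + real b) / 2))) \<longlonglongrightarrow> 0"
  proof (rule Lim_null_comparison[OF _ tendsto_norm_zero[OF regular_step[OF Suc.prems(1) b]]])
    show "\<forall>\<^sub>F n in sequentially. norm (norm (transfer q g (Suc n) y) - norm (transfer q g n ((y + real b) / 2)))
        \<le> norm (transfer q g (Suc n) y - q ((y + real b) / 2) * transfer q g n ((y + real b) / 2))"
      using norm_triangle_ineq3[of "transfer q g (Suc _) y"
         "q ((y + real b) / 2) * transfer q g _ ((y + real b) / 2)"]
      by (intro always_eventually allI) (simp add: norm_mult q)
  qed
  have "(\<lambda>n. norm (transfer q g (n + Suc j) y) - norm (transfer q g (n + j) ((y + real b) / 2))) \<longlonglongrightarrow> 0"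
    using LIMSEQ_ignore_initial_segment[OF step, of j] by simp
  from tendsto_add[OF this rest] show ?case
    by simp
qed simp

section \<open>Equicontinuity of the iterates\<close>

text \<open>The index \<open>a\<close> runs over the inverse branches of the \<open>i\<close>-fold
  doubling map: a mean variation of \<open>f\<close> between the backward trees of \<open>y\<close>
  and \<open>y'\<close>.\<close>

definition branch_osc :: "(real \<Rightarrow> complex) \<Rightarrow> nat \<Rightarrow> real \<Rightarrow> real \<Rightarrow> real" where
  "branch_osc f i y y' = (\<Sum>a<2^i. norm (f ((real a + y) / 2^i) - f ((real a + y') / 2^i))) / 2^i"

lemma sum_even_odd:
  fixes F :: "nat \<Rightarrow> 'a::comm_monoid_add"
  shows "(\<Sum>a<2 * n. F a) = (\<Sum>a<n. F (2 * a)) + (\<Sum>a<n. F (Suc (2 * a)))"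
  by (induction n) (auto simp: ac_simps)

lemma sum_lessThan_add:
  fixes F :: "nat \<Rightarrow> 'a::comm_monoid_add"
  shows "(\<Sum>a<m + n. F a) = (\<Sum>a<m. F a) + (\<Sum>a<n. F (m + a))"
  by (induction n) (auto simp: ac_simps)

lemma branch_osc_Suc:
  "branch_osc f (Suc i) y y' =
    (branch_osc f i (y / 2) (y' / 2) + branch_osc f i ((y + 1) / 2) ((y' + 1) / 2)) / 2"
proof -
  have e: "(real (2 * a) + z) / 2^Suc i = (real a + z / 2) / 2^i"
    "(real (Suc (2 * a)) + z) / 2^Suc i = (real a + (z + 1) / 2) / 2^i" for a z
    by (simp_all add: field_simps)
  show ?thesis
    unfolding branch_osc_def power_Suc[of "2::nat" i] sum_even_odd e
    by (simp add: field_simps)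
qed

lemma norm_mult_diff_le:
  fixes p p' u u' :: complex
  assumes "norm p \<le> 1" "norm u' \<le> 1"
  shows "norm (p * u - p' * u') \<le> norm (p - p') + norm (u - u')"
proof -
  have "p * u - p' * u' = p * (u - u') + (p - p') * u'" by (simp add: algebra_simps)
  then have "norm (p * u - p' * u') \<le> norm p * norm (u - u') + norm (p - p') * norm u'"
    by (metis norm_mult norm_triangle_ineq)
  also have "\<dots> \<le> 1 * norm (u - u') + norm (p - p') * 1"
    using assms by (intro add_mono mult_mono) auto
  finally show ?thesis by simp
qed

text \<open>A product of factors of norm at most 1 changes by at most the sum of the changes of its
  factors. The start function is read at level \<open>n\<close>, the factors of \<open>q\<close> at
  levels 1 to \<open>n\<close>, whence \<open>Suc i\<close>.\<close>

lemma norm_transfer_diff_le: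
  assumes q: "\<And>x. norm (q x) \<le> 1" and g: "\<And>x. norm (g x) \<le> 1"
  shows "norm (transfer q g n y - transfer q g n y') \<le>
    branch_osc g n y y' + (\<Sum>i<n. branch_osc q (Suc i) y y')"
proof (induction n arbitrary: y y')
  case 0
  then show ?case by (simp add: branch_osc_def)
next
  case (Suc n)
  define U where "U = transfer q g n"
  have U: "norm (U x) \<le> 1" for x
    unfolding U_def using q g by (rule norm_transfer_le)
  have IH: "norm (U x - U x') \<le> branch_osc g n x x' + (\<Sum>i<n. branch_osc q (Suc i) x x')" for x x'
    unfolding U_def by (rule Suc.IH)
  let ?D = "\<lambda>x x'. q x * U x - q x' * U x'"
  let ?y0 = "y / 2" and ?z0 = "y' / 2" and ?y1 = "(y + 1) / 2" and ?z1 = "(y' + 1) / 2"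
  have D: "norm (?D x x') \<le> norm (q x - q x') +
      (branch_osc g n x x' + (\<Sum>i<n. branch_osc q (Suc i) x x'))" for x x'
    using norm_mult_diff_le[OF q[of x] U[of x'], of "U x" "q x'"] IH[of x x'] by simp
  have osc_1: "branch_osc q (Suc 0) y y' = (norm (q ?y0 - q ?z0) + norm (q ?y1 - q ?z1)) / 2"
    unfolding branch_osc_Suc by (simp add: branch_osc_def)
  have osc_Suc: "(\<Sum>i<n. branch_osc q (Suc (Suc i)) y y') =
      ((\<Sum>i<n. branch_osc q (Suc i) ?y0 ?z0) + (\<Sum>i<n. branch_osc q (Suc i) ?y1 ?z1)) / 2"
    unfolding branch_osc_Suc[of q "Suc _" y y'] by (simp only: sum.distrib sum_divide_distrib[symmetric])
  have "transfer q g (Suc n) y - transfer q g (Suc n) y' = (?D ?y0 ?z0 + ?D ?y1 ?z1) / 2"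
    by (simp add: U_def transfer_Suc field_simps)
  then have "norm (transfer q g (Suc n) y - transfer q g (Suc n) y') = norm (?D ?y0 ?z0 + ?D ?y1 ?z1) / 2"
    by (simp only: norm_divide norm_numeral)
  also have "\<dots> \<le> (norm (?D ?y0 ?z0) + norm (?D ?y1 ?z1)) / 2"
    by (intro divide_right_mono norm_triangle_ineq) simp
  also have "\<dots> \<le> ((norm (q ?y0 - q ?z0) + (branch_osc g n ?y0 ?z0 + (\<Sum>i<n. branch_osc q (Suc i) ?y0 ?z0)))
      + (norm (q ?y1 - q ?z1) + (branch_osc g n ?y1 ?z1 + (\<Sum>i<n. branch_osc q (Suc i) ?y1 ?z1)))) / 2"
    by (intro divide_right_mono add_mono D) simp
  also have "\<dots> = branch_osc g (Suc n) y y' + (branch_osc q (Suc 0) y y'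
      + (\<Sum>i<n. branch_osc q (Suc (Suc i)) y y'))"
    unfolding osc_1 osc_Suc branch_osc_Suc[of g n] by (simp add: add_divide_distrib)
  also have "branch_osc q (Suc 0) y y' + (\<Sum>i<n. branch_osc q (Suc (Suc i)) y y')
      = (\<Sum>i<Suc n. branch_osc q (Suc i) y y')"
    by (rule sum.lessThan_Suc_shift[symmetric])
  finally show ?case .
qed

text \<open>The indicator of a half-line is monotone, and the two points with index \<open>a\<close>
  lie in the same closed dyadic interval, so the differences telescope to at most one jump.\<close>

lemma branch_osc_indicator_le:
  assumes "y \<in> {0..1}" "y' \<in> {0..1}"
  shows "branch_osc (indicator {..<b}) n y y' \<le> 1 / 2^n"
proof -
  define G where "G = (\<lambda>a. indicat_real {..<b} (real a / 2^n))"
  have "norm (indicator {..<b} ((real a + y) / 2^n) - indicator {..<b} ((real a + y') / 2^n) :: complex)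
      \<le> G a - G (Suc a)" for a
  proof -
    have "real a / 2^n \<le> (real a + x) / 2^n \<and> (real a + x) / 2^n \<le> real (Suc a) / 2^n"
      if "x \<in> {0..1}" for x
      using that by (auto simp: divide_right_mono)
    from this[OF assms(1)] this[OF assms(2)] show ?thesis
      unfolding G_def indicator_def by auto
  qed
  then have "(\<Sum>a<2^n. norm (indicator {..<b} ((real a + y) / 2^n) - indicator {..<b} ((real a + y') / 2^n) :: complex))
      \<le> (\<Sum>a<2^n. G a - G (Suc a))"
    by (rule sum_mono)
  also have "\<dots> = G 0 - G (2^n)"
    by (rule sum_lessThan_telescope')
  also have "\<dots> \<le> 1"
    by (simp add: G_def indicator_def)
  finally show ?thesis
    by (simp add: branch_osc_def divide_right_mono)
qed

text \<open>The norm is twice the absolute value of \<open>sin ((s - t) / 2)\<close>; bounding the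
  squared sine by its absolute value gives the exponent 1/2.\<close>

lemma norm_cis_diff_le: "norm (cis s - cis t) \<le> sqrt (2 * \<bar>s - t\<bar>)"
proof (rule real_le_rsqrt)
  have "(norm (cis s - cis t))\<^sup>2 = 2 - 2 * cos (s - t)"
    using sin_cos_squared_add[of s] sin_cos_squared_add[of t]
    by (simp only: cmod_power2 minus_complex.sel cis.sel cos_diff) (simp add: power2_eq_square algebra_simps)
  also have "cos (s - t) = 1 - 2 * (sin ((s - t) / 2))\<^sup>2"
    using cos_double_sin[of "(s - t) / 2"] by (simp del: right_diff_distrib_numeral)
  also have "2 - 2 * (1 - 2 * (sin ((s - t) / 2))\<^sup>2) = 4 * (sin ((s - t) / 2))\<^sup>2"
    by simp
  also have "(sin ((s - t) / 2))\<^sup>2 \<le> \<bar>sin ((s - t) / 2)\<bar>"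
    by (metis abs_ge_zero abs_sin_le_one mult_left_le power2_abs power2_eq_square)
  also have "\<dots> \<le> \<bar>(s - t) / 2\<bar>"
    by (rule abs_sin_x_le_abs_x)
  finally show "(norm (cis s - cis t))\<^sup>2 \<le> 2 * \<bar>s - t\<bar>"
    by simp
qed

section \<open>The roof function and the oscillation of its phases\<close>

definition roof :: "real \<Rightarrow> real \<Rightarrow> real" where
  "roof c x = c / \<bar>x - 1/2\<bar>"

lemma roof_borel_measurable [measurable]: "roof c \<in> borel_measurable borel"
  unfolding roof_def[abs_def] by measurable

definition phase :: "real \<Rightarrow> real \<Rightarrow> real \<Rightarrow> complex" where
  "phase c k x = cis (k * roof c x)"

lemma cis_borel_measurable [measurable]: "cis \<in> borel_measurable borel"
  by (intro borel_measurable_continuous_onI continuous_intros)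

lemma phase_borel_measurable [measurable]: "phase c k \<in> borel_measurable borel"
  unfolding phase_def[abs_def] by measurable

lemma norm_phase [simp]: "norm (phase c k x) = 1"
  by (simp add: phase_def)

lemma roof_diff_le:
  assumes "c \<ge> 0" "0 < m" "m \<le> \<bar>x - 1/2\<bar>" "m \<le> \<bar>x' - 1/2\<bar>"
  shows "\<bar>roof c x - roof c x'\<bar> \<le> c * \<bar>x - x'\<bar> / m\<^sup>2"
proof -
  define u v where "u = \<bar>x - 1/2\<bar>" and "v = \<bar>x' - 1/2\<bar>"
  have uv: "0 < u" "0 < v" "m \<le> u" "m \<le> v" using assms by (auto simp: u_def v_def)
  have "roof c x - roof c x' = c * (v - u) / (u * v)"
    unfolding roof_def u_def[symmetric] v_def[symmetric] using uv(1,2) by (simp add: field_simps)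
  then have "\<bar>roof c x - roof c x'\<bar> = c * \<bar>v - u\<bar> / (u * v)"
    using uv assms(1) by (simp add: abs_mult)
  also have "\<dots> \<le> c * \<bar>x - x'\<bar> / m\<^sup>2"
    unfolding power2_eq_square using uv assms
    by (intro frac_le mult_mono mult_left_mono) (auto simp: u_def v_def)
  finally show ?thesis .
qed

lemma harmonic_dyadic_le: "(\<Sum>a<2^l. 1 / real (Suc a)) \<le> real (Suc l)"
proof (induction l)
  case (Suc l)
  have "(\<Sum>a<2^l. 1 / real (Suc (2^l + a))) \<le> (\<Sum>a<(2::nat)^l. 1 / 2^l)"
    by (intro sum_mono frac_le) auto
  also have "\<dots> = 1" by simp
  finally show ?case
    using Suc sum_lessThan_add[of "\<lambda>a. 1 / real (Suc a)" "2^l" "2^l"] by (simp add: mult_2)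
qed simp

text \<open>The square root in \<open>norm_cis_diff_le\<close> is what makes the bound summable: the roof differences
  at the \<open>2\<^sup>l\<close> branch points are of order \<open>2\<^sup>l / w\<^sup>2\<close>, with \<open>w\<close> the index distance to the singularity, so
  their mean does not decay in \<open>l\<close>, while the mean of their square roots is a harmonic sum
  times \<open>2\<^sup>-\<^sup>l\<^sup>/\<^sup>2\<close>.\<close>

lemma branch_osc_phase_le:
  assumes "c \<ge> 0" "0 < r" "y \<in> {r..1 - r}" "y' \<in> {r..1 - r}"
  shows "branch_osc (phase c k) (Suc l) y y' \<le>
    sqrt (2 * \<bar>k\<bar> * c * \<bar>y - y'\<bar>) / r * (2 * real (Suc l) * (1 / sqrt 2)^Suc l)"
proof -
  define N where "N = (2::real)^Suc l"
  define K where "K = sqrt (2 * \<bar>k\<bar> * c * \<bar>y - y'\<bar>)"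
  \<comment> \<open>The singularity 1/2 is \<open>2^l / N\<close>, the common end point of the
    dyadic intervals with index \<open>2^l - 1\<close> and \<open>2^l\<close>. The weight
    \<open>w\<close> counts intervals away from it, starting with 1 on both sides.\<close>
  define w where "w = (\<lambda>a::nat. if a < 2^l then 2^l - real a else real (Suc a) - 2^l)"
  have N: "0 < N" by (simp add: N_def)
  have term_le: "norm (phase c k ((real a + y) / N) - phase c k ((real a + y') / N)) \<le> K * sqrt N / r * (1 / w a)" for a
  proof -
    have w: "w a \<ge> 1"
    proof (cases "a < 2^l")
      case True
      then have "real (Suc a) \<le> real (2^l)" by (simp only: of_nat_le_iff Suc_le_eq)
      then show ?thesis using True by (simp add: w_def)
    next
      case False
      then have "real (2^l) \<le> real a" by (simp only: of_nat_le_iff not_less)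
      then show ?thesis using False by (simp add: w_def)
    qed
    \<comment> \<open>The margin \<open>r\<close> inside each interval gives distance at least
      \<open>(w a - 1 + r) / N\<close>, and \<open>w a - 1 + r\<close> is at least
      \<open>r * w a\<close> because \<open>r \<le> 1\<close>.\<close>
    have lower: "r * w a / N \<le> \<bar>(real a + x) / N - 1/2\<bar>" if x: "x \<in> {r..1 - r}" for x
    proof -
      have "(real a + x) / N - 1/2 = (real a + x - 2^l) / N"
        by (simp add: N_def field_simps)
      then have "\<bar>(real a + x) / N - 1/2\<bar> = \<bar>real a + x - 2^l\<bar> / N"
        using N by simp
      moreover have "r * w a \<le> \<bar>real a + x - 2^l\<bar>"
      proof (cases "a < 2^l")
        case True
        have "r * (w a - 1) \<le> 1 * (w a - 1)"
          using assms(3) w by (intro mult_right_mono) auto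
        then have "r * w a \<le> w a - 1 + r" by (simp add: algebra_simps)
        also have "\<dots> \<le> 2^l - real a - x" using True x by (simp add: w_def)
        also have "\<dots> \<le> \<bar>real a + x - 2^l\<bar>" by simp
        finally show ?thesis .
      next
        case False
        have "r * (w a - 1) \<le> 1 * (w a - 1)"
          using assms(3) w by (intro mult_right_mono) auto
        then have "r * w a \<le> w a - 1 + r" by (simp add: algebra_simps)
        also have "\<dots> \<le> real a + x - 2^l" using False x by (simp add: w_def)
        also have "\<dots> \<le> \<bar>real a + x - 2^l\<bar>" by simp
        finally show ?thesis .
      qed
      ultimately show ?thesis using N by (simp add: divide_right_mono)
    qed
    have "\<bar>roof c ((real a + y) / N) - roof c ((real a + y') / N)\<bar>
        \<le> c * \<bar>(real a + y) / N - (real a + y') / N\<bar> / (r * w a / N)\<^sup>2"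
      using assms w N by (intro roof_diff_le lower) auto
    also have "(real a + y) / N - (real a + y') / N = (y - y') / N"
      by (simp add: diff_divide_distrib[symmetric])
    also have "c * \<bar>(y - y') / N\<bar> / (r * w a / N)\<^sup>2 = c * \<bar>y - y'\<bar> * N / (r * w a)\<^sup>2"
      using N assms w by (simp add: abs_divide power2_eq_square field_simps)
    finally have roof_le: "\<bar>roof c ((real a + y) / N) - roof c ((real a + y') / N)\<bar>
        \<le> c * \<bar>y - y'\<bar> * N / (r * w a)\<^sup>2" .
    have "norm (phase c k ((real a + y) / N) - phase c k ((real a + y') / N))
        \<le> sqrt (2 * \<bar>k * roof c ((real a + y) / N) - k * roof c ((real a + y') / N)\<bar>)"
      unfolding phase_def by (rule norm_cis_diff_le)
    also have "\<dots> = sqrt (2 * (\<bar>k\<bar> * \<bar>roof c ((real a + y) / N) - roof c ((real a + y') / N)\<bar>))"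
      by (simp add: right_diff_distrib[symmetric] abs_mult)
    also have "\<dots> \<le> sqrt (2 * (\<bar>k\<bar> * (c * \<bar>y - y'\<bar> * N / (r * w a)\<^sup>2)))"
      by (intro real_sqrt_le_mono mult_left_mono roof_le) auto
    also have "\<dots> = sqrt (2 * \<bar>k\<bar> * c * \<bar>y - y'\<bar> * N / (r * w a)\<^sup>2)"
      by (simp add: mult.assoc)
    also have "\<dots> = K * sqrt N / r * (1 / w a)"
      using assms w N by (simp add: K_def real_sqrt_divide real_sqrt_mult)
    finally show ?thesis .
  qed
  \<comment> \<open>Each side of the singularity contributes the same harmonic sum; the left one is
    read backwards.\<close>
  have "(\<Sum>a<2^Suc l. 1 / w a) = (\<Sum>a<2^l. 1 / w a) + (\<Sum>a<2^l. 1 / w (2^l + a))"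
    using sum_lessThan_add[of "\<lambda>a. 1 / w a" "2^l" "2^l"] by (simp add: mult_2)
  also have "(\<Sum>a<2^l. 1 / w a) = (\<Sum>a<2^l. 1 / real (Suc (2^l - Suc a)))"
    by (intro sum.cong) (auto simp: w_def of_nat_diff Suc_diff_Suc)
  also have "\<dots> = (\<Sum>a<2^l. 1 / real (Suc a))"
    by (rule sum.nat_diff_reindex)
  also have "(\<Sum>a<2^l. 1 / w (2^l + a)) = (\<Sum>a<2^l. 1 / real (Suc a))"
    by (intro sum.cong) (auto simp: w_def)
  finally have w_sum: "(\<Sum>a<2^Suc l. 1 / w a) \<le> 2 * real (Suc l)"
    using harmonic_dyadic_le[of l] by simp
  have "branch_osc (phase c k) (Suc l) y y' \<le> (\<Sum>a<2^Suc l. K * sqrt N / r * (1 / w a)) / N"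
    unfolding branch_osc_def N_def[symmetric] using N
    by (intro divide_right_mono sum_mono term_le) auto
  also have "\<dots> = K * sqrt N / r * (\<Sum>a<2^Suc l. 1 / w a) / N"
    by (simp only: sum_distrib_left)
  also have "\<dots> \<le> K * sqrt N / r * (2 * real (Suc l)) / N"
    using N assms by (intro divide_right_mono mult_left_mono w_sum) (auto simp: K_def)
  also have "\<dots> = K / r * (2 * real (Suc l) * (sqrt N / N))"
    by simp
  also have "sqrt N / N = (1 / sqrt 2)^Suc l"
    using real_div_sqrt[of N] N
    by (simp add: N_def real_sqrt_power[symmetric] power_one_over real_sqrt_mult field_simps del: power_Suc)
  finally show ?thesis
    by (simp add: K_def)
qed

text \<open>The phase oscillations are dominated by a convergent series of terms
  \<open>real (Suc l) * s^Suc l\<close>, so one constant serves all \<open>n\<close>; the term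
  \<open>1 / 2^n\<close> comes from the indicator. The margin \<open>r\<close> keeps the branch
  points at which phases are read off 1/2.\<close>

lemma transfer_phase_equicontinuous:
  assumes "c \<ge> 0" "0 < r"
  obtains C where "C \<ge> 0"
    "\<And>n y y'. y \<in> {r..1 - r} \<Longrightarrow> y' \<in> {r..1 - r} \<Longrightarrow>
      norm (transfer (phase c k) (indicator {..<b}) n y - transfer (phase c k) (indicator {..<b}) n y')
        \<le> 1 / 2^n + C * sqrt \<bar>y - y'\<bar>"
proof -
  define s where "s = 1 / sqrt (2::real)"
  have s: "0 < s" "s < 1" by (auto simp: s_def)
  then have "(\<lambda>l. real (Suc l) * s^l) sums (1 / (1 - s)\<^sup>2)"
    by (intro geometric_deriv_sums) simp
  then have sums: "(\<lambda>l. 2 * real (Suc l) * s^Suc l) sums (2 * s * (1 / (1 - s)\<^sup>2))"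
    using sums_mult[of _ _ "2 * s"] by (fastforce simp: ac_simps)
  define S where "S = 2 * s * (1 / (1 - s)\<^sup>2)"
  have partial: "(\<Sum>l<n. 2 * real (Suc l) * s^Suc l) \<le> S" for n
    using sum_le_suminf[OF sums_summable[OF sums], of "{..<n}"] sums_unique[OF sums] s
    by (simp add: S_def)
  show ?thesis
  proof (rule that[of "sqrt (2 * \<bar>k\<bar> * c) / r * S"])
    show "0 \<le> sqrt (2 * \<bar>k\<bar> * c) / r * S"
      using assms s by (auto simp: S_def)
    fix n y y' assume y: "y \<in> {r..1 - r}" "y' \<in> {r..1 - r}"
    have "norm (transfer (phase c k) (indicator {..<b}) n y - transfer (phase c k) (indicator {..<b}) n y')
        \<le> branch_osc (indicator {..<b}) n y y' + (\<Sum>l<n. branch_osc (phase c k) (Suc l) y y')"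
      by (rule norm_transfer_diff_le) (auto simp: indicator_def)
    also have "\<dots> \<le> 1 / 2^n + (\<Sum>l<n. sqrt (2 * \<bar>k\<bar> * c * \<bar>y - y'\<bar>) / r * (2 * real (Suc l) * s^Suc l))"
      unfolding s_def using y assms
      by (intro add_mono branch_osc_indicator_le sum_mono branch_osc_phase_le) auto
    also have "\<dots> = 1 / 2^n + sqrt (2 * \<bar>k\<bar> * c * \<bar>y - y'\<bar>) / r * (\<Sum>l<n. 2 * real (Suc l) * s^Suc l)"
      by (simp only: sum_distrib_left)
    also have "\<dots> \<le> 1 / 2^n + sqrt (2 * \<bar>k\<bar> * c * \<bar>y - y'\<bar>) / r * S"
      using assms by (intro add_left_mono mult_left_mono partial) auto
    also have "\<dots> = 1 / 2^n + sqrt (2 * \<bar>k\<bar> * c) / r * S * sqrt \<bar>y - y'\<bar>"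
      by (simp add: real_sqrt_mult)
    finally show "norm (transfer (phase c k) (indicator {..<b}) n y - transfer (phase c k) (indicator {..<b}) n y')
        \<le> 1 / 2^n + sqrt (2 * \<bar>k\<bar> * c) / r * S * sqrt \<bar>y - y'\<bar>" .
  qed
qed

section \<open>Decay of the iterates\<close>

text \<open>A nonempty open set has positive measure, so it cannot lie in the exceptional
  set.\<close>

lemma AE_unit_lebesgue_open:
  assumes "AE x in unit_lebesgue. P x" "open W" "W \<noteq> {}" "W \<subseteq> {0<..<1}"
  obtains x where "x \<in> W" "P x"
proof -
  have W: "W \<in> sets unit_lebesgue"
    using assms(2,4) by (auto simp: sets_unit_lebesgue_iff)
  have "W \<notin> null_sets lborel"
    using assms(2,3) by (metis interior_open null_sets_completionI negligible_iff_null_sets open_not_negligible)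
  then have "W \<notin> null_sets unit_lebesgue"
    using W by (auto simp: null_sets_def emeasure_unit_lebesgue sets_unit_lebesgue_iff)
  then have "\<not> (AE x in unit_lebesgue. x \<notin> W)"
    using W AE_iff_null_sets[OF W] by simp
  then have "\<exists>x\<in>W. P x"
    using eventually_mono[OF assms(1), of "\<lambda>x. x \<notin> W"] by blast
  then show ?thesis using that by blast
qed

text \<open>The inverse branches of the square of the doubling map through \<open>1/2 + t\<close> and \<open>3/4 + t\<close>
  both lead to \<open>4t\<close>. As \<open>t\<close> tends to 0 the ratio of their phases oscillates without limit,
  whereas the iterates are equicontinuous near \<open>1/2\<close> and \<open>3/4\<close>.\<close>

definition phase_ratio :: "real \<Rightarrow> real \<Rightarrow> real \<Rightarrow> complex" where
  "phase_ratio c k t = cis (k * (c / (2 * t))) * cis (k * (c / (1/2 - 2 * t) - c / (1/4 + t)))"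

lemma norm_phase_ratio [simp]: "norm (phase_ratio c k t) = 1"
  by (simp add: phase_ratio_def norm_mult)

text \<open>Along a sequence tending to 0 the singular factor is \<open>(-1)^m\<close> while the
  other factor converges to its value \<open>v\<close> at 0; even and odd \<open>m\<close> give
  nearly opposite values.\<close>

lemma phase_ratio_oscillates:
  assumes c: "c > 0" and k: "k \<noteq> 0" and d: "0 < d"
  obtains t1 t2 v where "t1 \<in> {0<..<d}" "t2 \<in> {0<..<d}" "norm v = 1"
    "norm (phase_ratio c k t1 - v) < 1/2" "norm (phase_ratio c k t2 + v) < 1/2"
proof -
  \<comment> \<open>Chosen so that \<open>k * (c / (2 * t m))\<close> is plus or minus
    \<open>pi * real m\<close>.\<close>
  define t where "t = (\<lambda>m::nat. c * \<bar>k\<bar> / (2 * pi * real m))"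
  define w where "w = (\<lambda>t. cis (k * (c / (1/2 - 2 * t) - c / (1/4 + t))))"
  define v where "v = w 0"
  have t0: "t \<longlonglongrightarrow> 0"
    using tendsto_mult_left[OF lim_1_over_n, of "c * \<bar>k\<bar> / (2 * pi)"] by (simp add: t_def)
  have "isCont w 0"
    unfolding w_def isCont_def by (intro tendsto_intros) auto
  then have "(\<lambda>m. w (t m)) \<longlonglongrightarrow> v"
    unfolding v_def by (rule isCont_tendsto_compose[OF _ t0])
  then have "\<forall>\<^sub>F m in sequentially. dist (w (t m)) v < 1/2"
    by (rule tendstoD) simp
  moreover have "\<forall>\<^sub>F m in sequentially. t m < d"
    using t0 d by (rule order_tendstoD)
  ultimately have "\<forall>\<^sub>F m in sequentially. m > 0 \<and> t m < d \<and> dist (w (t m)) v < 1/2"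
    using eventually_gt_at_top[of "0::nat"] by eventually_elim simp
  then obtain M where M: "\<And>m. m \<ge> M \<Longrightarrow> m > 0 \<and> t m < d \<and> dist (w (t m)) v < 1/2"
    by (auto simp: eventually_sequentially)
  have ratio: "phase_ratio c k (t m) = (-1)^m * w (t m)" if "m > 0" for m
  proof -
    have "k * (c / (2 * t m)) = sgn k * (pi * real m)"
      using that c k by (simp add: t_def sgn_if field_simps)
    moreover have "cis (sgn k * (pi * real m)) = (-1)^m"
    proof (cases "k > 0")
      case True
      then have "cis (sgn k * (pi * real m)) = cis pi ^ m"
        by (subst Complex.DeMoivre) (simp add: mult.commute)
      then show ?thesis by simp
    next
      case False
      then have "cis (sgn k * (pi * real m)) = cis (- pi) ^ m"
        using k by (subst Complex.DeMoivre) (simp add: mult.commute)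
      moreover have "cis (- pi) = -1"
        by (simp add: complex_eq_iff)
      ultimately show ?thesis by simp
    qed
    ultimately show ?thesis
      by (simp add: phase_ratio_def w_def)
  qed
  have tpos: "0 < t m" if "m > 0" for m
    using that c k by (simp add: t_def)
  show ?thesis
  proof (rule that[of "t (2 * Suc M)" "t (2 * Suc M + 1)" v])
    have 1: "2 * Suc M \<ge> M" and 2: "2 * Suc M + 1 \<ge> M" by simp_all
    show "t (2 * Suc M) \<in> {0<..<d}" "t (2 * Suc M + 1) \<in> {0<..<d}"
      using M[OF 1] M[OF 2] tpos by auto
    show "norm v = 1" by (simp add: v_def w_def)
    show "norm (phase_ratio c k (t (2 * Suc M)) - v) < 1/2"
      using M[OF 1] ratio[of "2 * Suc M"] by (simp add: dist_norm)
    have "norm (phase_ratio c k (t (2 * Suc M + 1)) + v) = norm (w (t (2 * Suc M + 1)) - v)"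
      using ratio[of "2 * Suc M + 1"] by (simp add: norm_minus_commute)
    then show "norm (phase_ratio c k (t (2 * Suc M + 1)) + v) < 1/2"
      using M[OF 2] by (simp add: dist_norm)
  qed
qed

text \<open>Two backward steps lead from \<open>4 * t\<close> to either point: one path runs through
  \<open>2 * t\<close> to \<open>1/2 + t\<close>, the other through \<open>1/2 + 2 * t\<close> to
  \<open>3/4 + t\<close>. Comparing both with the same iterate at \<open>4 * t\<close> and dividing
  by the phases of the second path leaves \<open>phase_ratio\<close>.\<close>

lemma regular_phase_ratio:
  assumes "c > 0" and reg: "regular (phase c k) g (4 * t)" and t: "0 < t" "t < 1/8"
  shows "(\<lambda>n. phase_ratio c k t * transfer (phase c k) g n (1/2 + t) - transfer (phase c k) g n (3/4 + t)) \<longlonglongrightarrow> 0"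
proof -
  define U where "U = transfer (phase c k) g"
  define q where "q = phase c k"
  have two: "(\<lambda>n. U (Suc (Suc n)) (4 * t) - q ((4 * t + real b) / 2) *
      (q (((4 * t + real b) / 2 + 1) / 2) * U n (((4 * t + real b) / 2 + 1) / 2))) \<longlonglongrightarrow> 0" if "b < 2" for b
  proof -
    let ?y = "(4 * t + real b) / 2"
    have "(\<lambda>n. U (Suc (Suc n)) (4 * t) - q ?y * U (Suc n) ?y) \<longlonglongrightarrow> 0"
      using LIMSEQ_ignore_initial_segment[OF regular_step[OF reg that], of 1] by (simp add: U_def q_def)
    moreover have "(\<lambda>n. q ?y * (U (Suc n) ?y - q ((?y + 1) / 2) * U n ((?y + 1) / 2))) \<longlonglongrightarrow> 0"
      using tendsto_mult_left[OF regular_step[OF regular_branch[OF reg that], of 1], of "q ?y"]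
      by (simp add: U_def q_def)
    ultimately have "(\<lambda>n. (U (Suc (Suc n)) (4 * t) - q ?y * U (Suc n) ?y)
        + q ?y * (U (Suc n) ?y - q ((?y + 1) / 2) * U n ((?y + 1) / 2))) \<longlonglongrightarrow> 0 + 0"
      by (rule tendsto_add)
    then show ?thesis
      by (simp add: algebra_simps)
  qed
  have pts: "(4 * t + real 0) / 2 = 2 * t" "(2 * t + 1) / 2 = 1/2 + t"
      "(4 * t + real 1) / 2 = 1/2 + 2 * t" "(1/2 + 2 * t + 1) / 2 = 3/4 + t"
    by (auto simp: field_simps)
  have lim: "(\<lambda>n. q (1/2 + 2 * t) * (q (3/4 + t) * U n (3/4 + t)) - q (2 * t) * (q (1/2 + t) * U n (1/2 + t))) \<longlonglongrightarrow> 0"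
    using tendsto_diff[OF two[of 0] two[of 1]] unfolding pts by (simp add: pts)
  have abs_pts: "\<bar>2 * t - 1/2\<bar> = 1/2 - 2 * t" "\<bar>1/2 + t - 1/2\<bar> = t"
      "\<bar>1/2 + 2 * t - 1/2\<bar> = 2 * t" "\<bar>3/4 + t - 1/2\<bar> = 1/4 + t"
    using t by auto
  have vals: "q (2 * t) = cis (k * (c / (1/2 - 2 * t)))" "q (1/2 + t) = cis (k * (c / t))"
      "q (1/2 + 2 * t) = cis (k * (c / (2 * t)))" "q (3/4 + t) = cis (k * (c / (1/4 + t)))"
    using abs_pts by (simp_all add: q_def phase_def roof_def)
  \<comment> \<open>The inverse of the phases on the path to \<open>3/4 + t\<close>. Of the singular
    terms \<open>c / t\<close> on the first path and \<open>c / (2 * t)\<close> on the second, the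
    difference \<open>c / (2 * t)\<close> survives.\<close>
  define w where "w = cis (- (k * (c / (2 * t))) - k * (c / (1/4 + t)))"
  have c_t: "c / t = 2 * (c / (2 * t))" by simp
  have collect: "- (k * a) - k * e + k * b + k * (2 * a) = k * a + k * (b - e)" for a b e :: real
    by (simp add: algebra_simps)
  have inverse: "w * q (1/2 + 2 * t) * q (3/4 + t) = 1"
    unfolding vals w_def by (simp add: cis_mult)
  have ratio: "w * q (2 * t) * q (1/2 + t) = phase_ratio c k t"
    unfolding vals w_def phase_ratio_def cis_mult
    by (subst c_t) (simp only: collect)
  have "- w * (q (1/2 + 2 * t) * (q (3/4 + t) * U n (3/4 + t)) - q (2 * t) * (q (1/2 + t) * U n (1/2 + t)))
      = w * q (2 * t) * q (1/2 + t) * U n (1/2 + t) - w * q (1/2 + 2 * t) * q (3/4 + t) * U n (3/4 + t)" for n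
    by (simp add: algebra_simps)
  then show ?thesis
    using tendsto_mult_left[OF lim, of "- w"] unfolding inverse ratio by (simp add: U_def)
qed

text \<open>With ratios near \<open>v\<close> and \<open>- v\<close> at two small \<open>t\<close>,
  the value at 3/4 is close to both \<open>v\<close> and \<open>- v\<close> times the value at 1/2,
  so the latter is small.\<close>

lemma transfer_phase_half_tendsto:
  assumes c: "c > 0" and k: "k \<noteq> 0"
  shows "(\<lambda>n. transfer (phase c k) (indicator {..<b}) n (1/2)) \<longlonglongrightarrow> 0"
proof -
  define g where "g = (indicator {..<b} :: real \<Rightarrow> complex)"
  define U where "U = transfer (phase c k) g"
  have [measurable]: "g \<in> borel_measurable borel" by (simp add: g_def)
  have reg: "AE y in unit_lebesgue. regular (phase c k) g y"
    by (rule AE_regular) (auto simp: g_def indicator_def)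
  obtain C where C: "C \<ge> 0" "\<And>n y y'. y \<in> {1/8..1 - 1/8} \<Longrightarrow> y' \<in> {1/8..1 - 1/8} \<Longrightarrow>
      norm (U n y - U n y') \<le> 1 / 2^n + C * sqrt \<bar>y - y'\<bar>"
    using transfer_phase_equicontinuous[of c "1/8" k b] c unfolding U_def g_def by (metis less_imp_le zero_less_divide_1_iff zero_less_numeral)
  show ?thesis
  proof (rule LIMSEQ_I)
    fix e :: real assume "0 < e"
    define e' where "e' = e / 6"
    have e': "0 < e'" using \<open>0 < e\<close> by (simp add: e'_def)
    \<comment> \<open>The bound 1/8 keeps \<open>3/4 + t\<close> in the interval of equicontinuity;
      the square makes \<open>C * sqrt t\<close> at most \<open>e'\<close>, with
      \<open>C + 1\<close> covering \<open>C = 0\<close>.\<close>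
    define d where "d = min (1/8) ((e' / (C + 1))\<^sup>2)"
    have d: "0 < d" "d \<le> 1/8"
      using e' C(1) by (auto simp: d_def)
    have Cd: "C * sqrt t \<le> e'" if "0 \<le> t" "t \<le> d" for t
    proof -
      have "sqrt t \<le> sqrt ((e' / (C + 1))\<^sup>2)"
        using that by (intro real_sqrt_le_mono) (simp add: d_def)
      then have "sqrt t \<le> e' / (C + 1)" using e' C(1) by simp
      then have "C * sqrt t \<le> C * (e' / (C + 1))" using C(1) by (rule mult_left_mono)
      also have "\<dots> \<le> e'" using e' C(1) by (simp add: field_simps)
      finally show ?thesis .
    qed
    obtain s1 s2 v where s: "s1 \<in> {0<..<d}" "s2 \<in> {0<..<d}" and v: "norm v = 1"
      and s1: "norm (phase_ratio c k s1 - v) < 1/2" and s2: "norm (phase_ratio c k s2 + v) < 1/2"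
      using phase_ratio_oscillates[OF c k d(1)] .
    have cont: "continuous_on {0<..<4 * d} (\<lambda>y. phase_ratio c k (y / 4))"
      unfolding phase_ratio_def using d by (intro continuous_intros) auto
    \<comment> \<open>The points found by oscillation need not be regular. The ratio condition is
      open and regular points have full measure, so some regular point satisfies it.\<close>
    have regular_near: "\<exists>t. t \<in> {0<..<d} \<and> regular (phase c k) g (4 * t) \<and> norm (phase_ratio c k t - u) < 1/2"
      if "s \<in> {0<..<d}" "norm (phase_ratio c k s - u) < 1/2" for s u
    proof -
      define W where "W = {0<..<4 * d} \<inter> (\<lambda>y. phase_ratio c k (y / 4)) -` ball u (1/2)"
      have "open W"
        unfolding W_def using cont by (intro continuous_open_preimage) auto
      moreover have "4 * s \<in> W"
        using that by (auto simp: W_def dist_norm norm_minus_commute)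
      then have "W \<noteq> {}" by blast
      moreover have "W \<subseteq> {0<..<1}"
        using d by (auto simp: W_def)
      ultimately obtain y where "y \<in> W" "regular (phase c k) g y"
        using AE_unit_lebesgue_open[OF reg, of W] by blast
      then show ?thesis
        by (intro exI[of _ "y / 4"]) (auto simp: W_def dist_norm norm_minus_commute)
    qed
    obtain t1 where t1: "t1 \<in> {0<..<d}" "regular (phase c k) g (4 * t1)" "norm (phase_ratio c k t1 - v) < 1/2"
      using regular_near[OF s(1) s1] by blast
    obtain t2 where t2: "t2 \<in> {0<..<d}" "regular (phase c k) g (4 * t2)" "norm (phase_ratio c k t2 - (- v)) < 1/2"
      using regular_near[of s2 "- v"] s(2) s2 by auto
    define D where "D = (\<lambda>t n. phase_ratio c k t * U n (1/2 + t) - U n (3/4 + t))"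
    have D: "(\<lambda>n. D t n) \<longlonglongrightarrow> 0" if "t \<in> {0<..<d}" "regular (phase c k) g (4 * t)" for t
      unfolding D_def U_def using that d c by (intro regular_phase_ratio) auto
    have near: "norm (phase_ratio c k t * U n (1/2) - U n (3/4)) \<le> norm (D t n) + 2 * (1 / 2^n + e')"
      if t: "t \<in> {0<..<d}" for t n
    proof -
      have 1: "norm (U n (1/2) - U n (1/2 + t)) \<le> 1 / 2^n + e'"
        using C(2)[of "1/2" "1/2 + t" n] Cd[of t] t d by auto
      have 2: "norm (U n (3/4 + t) - U n (3/4)) \<le> 1 / 2^n + e'"
        using C(2)[of "3/4 + t" "3/4" n] Cd[of t] t d by auto
      have "phase_ratio c k t * U n (1/2) - U n (3/4) =
          D t n + (phase_ratio c k t * (U n (1/2) - U n (1/2 + t)) + (U n (3/4 + t) - U n (3/4)))"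
        by (simp add: D_def algebra_simps)
      also have "norm \<dots> \<le> norm (D t n) + (norm (phase_ratio c k t * (U n (1/2) - U n (1/2 + t)))
          + norm (U n (3/4 + t) - U n (3/4)))"
        by (intro norm_triangle_mono norm_triangle_ineq order_refl)
      also have "\<dots> \<le> norm (D t n) + 2 * (1 / 2^n + e')"
        using 1 2 by (simp add: norm_mult)
      finally show ?thesis .
    qed
    \<comment> \<open>The two values lie within 1/2 of \<open>v\<close> and \<open>- v\<close>,
      whose distance is 2.\<close>
    have gap: "1 \<le> norm (phase_ratio c k t1 - phase_ratio c k t2)"
    proof -
      have "2 * v = (phase_ratio c k t1 - phase_ratio c k t2) - (phase_ratio c k t1 - v)
          + (phase_ratio c k t2 - (- v))" by simp
      then have "norm (2 * v) \<le> norm (phase_ratio c k t1 - phase_ratio c k t2)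
          + norm (phase_ratio c k t1 - v) + norm (phase_ratio c k t2 - (- v))"
        by (metis norm_triangle_ineq norm_triangle_ineq4 norm_triangle_mono order_refl)
      then show ?thesis using t1(3) t2(3) v by (simp add: norm_mult)
    qed
    have bound: "norm (U n (1/2)) \<le> norm (D t1 n) + norm (D t2 n) + 4 * (1 / 2^n) + 4 * e'" for n
    proof -
      have "norm (U n (1/2)) \<le> norm (phase_ratio c k t1 - phase_ratio c k t2) * norm (U n (1/2))"
        using mult_right_mono[OF gap norm_ge_zero[of "U n (1/2)"]] by simp
      also have "\<dots> = norm ((phase_ratio c k t1 * U n (1/2) - U n (3/4)) - (phase_ratio c k t2 * U n (1/2) - U n (3/4)))"
        by (simp add: norm_mult[symmetric] algebra_simps)
      also have "\<dots> \<le> norm (phase_ratio c k t1 * U n (1/2) - U n (3/4)) + norm (phase_ratio c k t2 * U n (1/2) - U n (3/4))"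
        by (rule norm_triangle_ineq4)
      also have "\<dots> \<le> norm (D t1 n) + norm (D t2 n) + 4 * (1 / 2^n) + 4 * e'"
        using near[OF t1(1), of n] near[OF t2(1), of n] by simp
      finally show ?thesis .
    qed
    have "(\<lambda>n. norm (D t1 n) + norm (D t2 n) + 4 * (1 / 2^n) + 4 * e') \<longlonglongrightarrow> 0 + 0 + 4 * 0 + 4 * e'"
      by (intro tendsto_intros tendsto_norm_zero D t1 t2 LIMSEQ_divide_realpow_zero) auto
    then have "\<forall>\<^sub>F n in sequentially. norm (D t1 n) + norm (D t2 n) + 4 * (1 / 2^n) + 4 * e' < e"
      by (rule order_tendstoD(2)) (use \<open>0 < e\<close> in \<open>simp add: e'_def\<close>)
    then have "\<forall>\<^sub>F n in sequentially. norm (U n (1/2)) < e"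
      by eventually_elim (use bound in \<open>auto intro: le_less_trans\<close>)
    then show "\<exists>N. \<forall>n\<ge>N. norm (transfer (phase c k) (indicator {..<b}) n (1/2) - 0) < e"
      by (simp add: eventually_sequentially U_def g_def)
  qed
qed

text \<open>A regular \<open>y\<close> has an iterated preimage near 1/2; the norms at the two
  points agree asymptotically up to a time shift, and equicontinuity compares the preimage with 1/2
  itself.\<close>

lemma transfer_phase_tendsto_0:
  assumes c: "c > 0" and k: "k \<noteq> 0"
  shows "AE y in unit_lebesgue. (\<lambda>n. transfer (phase c k) (indicator {..<b}) n y) \<longlonglongrightarrow> 0"
proof -
  define g where "g = (indicator {..<b} :: real \<Rightarrow> complex)"
  define U where "U = transfer (phase c k) g"
  have [measurable]: "g \<in> borel_measurable borel" by (simp add: g_def)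
  obtain C where C: "C \<ge> 0" "\<And>n y y'. y \<in> {1/8..1 - 1/8} \<Longrightarrow> y' \<in> {1/8..1 - 1/8} \<Longrightarrow>
      norm (U n y - U n y') \<le> 1 / 2^n + C * sqrt \<bar>y - y'\<bar>"
    using transfer_phase_equicontinuous[of c "1/8" k b] c unfolding U_def g_def by (metis less_imp_le zero_less_divide_1_iff zero_less_numeral)
  have half: "(\<lambda>n. U n (1/2)) \<longlonglongrightarrow> 0"
    unfolding U_def g_def by (rule transfer_phase_half_tendsto[OF c k])
  have "AE y in unit_lebesgue. regular (phase c k) g y"
    by (rule AE_regular) (auto simp: g_def indicator_def)
  moreover have "(\<lambda>n. U n y) \<longlonglongrightarrow> 0" if reg: "regular (phase c k) g y" and y: "y \<in> {0..<1}" for y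
  proof (rule LIMSEQ_I)
    fix e :: real assume e: "0 < e"
    have "(\<lambda>j. C * sqrt (1 / 2^j)) \<longlonglongrightarrow> C * sqrt 0"
      by (intro tendsto_intros LIMSEQ_divide_realpow_zero) auto
    then have "\<forall>\<^sub>F j in sequentially. C * sqrt (1 / 2^j) < e / 2"
      using e by (intro order_tendstoD) auto
    with eventually_ge_at_top[of 2] obtain j :: nat where j: "2 \<le> j" "C * sqrt (1 / 2^j) < e / 2"
      using eventually_happens[OF eventually_conj] by fastforce
    \<comment> \<open>The branch with index \<open>2^(j - 1)\<close> sends \<open>y\<close> to
      \<open>1/2 + y / 2^j\<close>; as \<open>2 \<le> j\<close>, this is at most 3/4.\<close>
    define z where "z = (real (2^(j - 1)) + y) / 2^j"
    have z_eq: "z = 1/2 + y / 2^j"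
      using j(1) by (cases j) (auto simp: z_def field_simps)
    have "(4::real) \<le> 2^j"
      using power_increasing[OF j(1), of "2::real"] by simp
    then have small: "0 \<le> y / 2^j" "y / 2^j \<le> 1 / 2^j" "1 / 2^j \<le> (1/4::real)"
      using y by (auto simp: divide_right_mono field_simps)
    have close: "norm (U n z - U n (1/2)) \<le> 1 / 2^n + e / 2" for n
    proof -
      have "C * sqrt \<bar>z - 1/2\<bar> \<le> C * sqrt (1 / 2^j)"
        using small C(1) by (intro mult_left_mono real_sqrt_le_mono) (auto simp: z_eq)
      moreover have "z \<in> {1/8..1 - 1/8}"
        unfolding z_eq atLeastAtMost_iff using small by (intro conjI; linarith)
      then have "norm (U n z - U n (1/2)) \<le> 1 / 2^n + C * sqrt \<bar>z - 1/2\<bar>"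
        by (intro C(2)) auto
      ultimately show ?thesis
        using j(2) by linarith
    qed
    define E where "E = (\<lambda>n. norm (U (n + j) y) - norm (U n z))"
    have E: "E \<longlonglongrightarrow> 0"
      unfolding E_def U_def z_def using j by (intro regular_norm_tendsto reg) auto
    have bound: "norm (U (n + j) y) \<le> E n + norm (U n (1/2)) + 1 / 2^n + e / 2" for n
      using close[of n] norm_triangle_ineq2[of "U n z" "U n (1/2)"] by (simp add: E_def)
    have "(\<lambda>n. E n + norm (U n (1/2)) + 1 / 2^n + e / 2) \<longlonglongrightarrow> 0 + 0 + 0 + e / 2"
      by (intro tendsto_intros tendsto_norm_zero half E LIMSEQ_divide_realpow_zero) auto
    then have "\<forall>\<^sub>F n in sequentially. E n + norm (U n (1/2)) + 1 / 2^n + e / 2 < e"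
      by (rule order_tendstoD(2)) (use e in simp)
    then have "\<forall>\<^sub>F n in sequentially. norm (U (n + j) y) < e"
      by eventually_elim (use bound in \<open>auto intro: le_less_trans\<close>)
    then have "\<forall>\<^sub>F n in sequentially. norm (U n y) < e"
      by (subst (asm) eventually_sequentially_seg)
    then show "\<exists>N. \<forall>n\<ge>N. norm (U n y - 0) < e"
      by (simp add: eventually_sequentially)
  qed
  ultimately show ?thesis
    unfolding U_def g_def by (auto elim!: AE_mp)
qed

section \<open>Correlations over the doubling map\<close>

lemma measure_unit_lebesgue_lessThan:
  assumes "0 \<le> b" "b \<le> 1"
  shows "measure unit_lebesgue ({..<b} \<inter> {0..<1}) = b"
proof -
  have "{..<b} \<inter> {0..<1} = {0..<b}" using assms by auto
  then show ?thesis
    using assms by (simp add: measure_def emeasure_unit_lebesgue sets_unit_lebesgue_iff)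
qed

lemma integral_unit_lebesgue_indicator:
  "(\<integral>x. (indicator X x :: complex) \<partial>unit_lebesgue) = of_real (measure unit_lebesgue (X \<inter> {0..<1}))"
proof -
  have "(\<integral>x. (indicator X x :: complex) \<partial>unit_lebesgue) = (\<integral>x. complex_of_real (indicator X x) \<partial>unit_lebesgue)"
    by (simp add: of_real_indicator)
  also have "\<dots> = of_real (\<integral>x. indicator X x \<partial>unit_lebesgue)"
    by (rule integral_complex_of_real)
  finally show ?thesis by simp
qed

text \<open>For \<open>k = 0\<close> the phase is constantly 1 and only the indicator
  oscillates.\<close>

lemma norm_transfer_1_diff_le:
  assumes "y \<in> {0..1}" "y' \<in> {0..1}"
  shows "norm (transfer (phase c 0) (indicator {..<b}) n y - transfer (phase c 0) (indicator {..<b}) n y') \<le> 1 / 2^n"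
proof -
  have "norm (transfer (phase c 0) (indicator {..<b}) n y - transfer (phase c 0) (indicator {..<b}) n y')
      \<le> branch_osc (indicator {..<b}) n y y' + (\<Sum>l<n. branch_osc (phase c 0) (Suc l) y y')"
    by (rule norm_transfer_diff_le) (auto simp: indicator_def)
  also have "(\<Sum>l<n. branch_osc (phase c 0) (Suc l) y y') = 0"
    by (simp add: branch_osc_def phase_def)
  finally show ?thesis
    using branch_osc_indicator_le[OF assms, of b n] by simp
qed

text \<open>The untwisted operator preserves the integral, so every iterate has mean
  \<open>b\<close>, and its oscillation is at most \<open>1 / 2^n\<close>.\<close>

lemma transfer_1_tendsto:
  assumes b: "0 \<le> b" "b \<le> 1" and y: "y \<in> {0..<1}"
  shows "(\<lambda>n. transfer (phase c 0) (indicator {..<b}) n y) \<longlonglongrightarrow> of_real b"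
proof -
  define g where "g = (indicator {..<b} :: real \<Rightarrow> complex)"
  define U where "U = transfer (phase c 0) g"
  have [measurable]: "g \<in> borel_measurable borel" by (simp add: g_def)
  have [measurable]: "U n \<in> borel_measurable borel" for n
    unfolding U_def by measurable
  have g: "norm (g x) \<le> 1" for x
    by (simp add: g_def indicator_def)
  have U1: "norm (U n x) \<le> 1" for n x
    unfolding U_def by (rule norm_transfer_le) (auto simp: g)
  have U: "integrable unit_lebesgue (U n)" for n
    by (rule integrable_unit_lebesgue_bounded[OF _ U1]) measurable
  have mean: "integral\<^sup>L unit_lebesgue (U n) = of_real b" for n
  proof -
    have "integral\<^sup>L unit_lebesgue (U n) = integral\<^sup>L unit_lebesgue g"
      using integral_doubling_transfer[of "phase c 0" g "\<lambda>_. 1" 1 n] g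
      by (simp add: U_def phase_def)
    also have "\<dots> = of_real b"
      unfolding g_def integral_unit_lebesgue_indicator by (simp only: measure_unit_lebesgue_lessThan[OF b])
    finally show ?thesis .
  qed
  have bound: "norm (U n y - of_real b) \<le> 1 / 2^n" for n
  proof -
    have I: "integrable unit_lebesgue (\<lambda>x. U n y - U n x)"
      using U[of n] by simp
    have "U n y - of_real b = (\<integral>x. U n y - U n x \<partial>unit_lebesgue)"
      using U[of n] unit_lebesgue.prob_space by (simp add: mean)
    also have "norm \<dots> \<le> (\<integral>x. norm (U n y - U n x) \<partial>unit_lebesgue)"
      by (rule integral_norm_bound)
    also have "\<dots> \<le> 1 / 2^n"
      using I y unfolding U_def g_def
      by (intro unit_lebesgue.integral_le_const AE_I2 norm_transfer_1_diff_le) auto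
    finally show ?thesis .
  qed
  have "(\<lambda>n. U n y - of_real b) \<longlonglongrightarrow> 0"
    by (rule Lim_null_comparison[OF _ LIMSEQ_divide_realpow_zero[of 2 1]]) (auto simp: bound)
  then show ?thesis
    unfolding U_def g_def by (rule LIM_zero_cancel)
qed

definition birkhoff :: "real \<Rightarrow> nat \<Rightarrow> real \<Rightarrow> real" where
  "birkhoff c n x = (\<Sum>j<n. roof c ((doubling ^^ j) x))"

lemma birkhoff_borel_measurable [measurable]: "birkhoff c n \<in> borel_measurable borel"
  unfolding birkhoff_def[abs_def] by measurable

lemma prod_phase: "(\<Prod>j<n. phase c k ((doubling ^^ j) x)) = cis (k * birkhoff c n x)"
  by (induction n) (auto simp: birkhoff_def phase_def cis_mult algebra_simps)

text \<open>Duality turns the correlation into the integral of the iterates over \<open>X\<close>.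
  These converge almost everywhere and are bounded by 1, so dominated convergence applies.\<close>

lemma character_correlation_tendsto:
  assumes c: "c > 0" and X [measurable]: "X \<in> sets borel" and b: "0 \<le> b" "b \<le> 1"
  shows "(\<lambda>n. \<integral>x. indicator X ((doubling ^^ n) x) * cis (k * birkhoff c n x) * indicator {..<b} x \<partial>unit_lebesgue)
     \<longlonglongrightarrow> (if k = 0 then of_real (measure unit_lebesgue (X \<inter> {0..<1}) * b) else 0)"
proof -
  define g where "g = (indicator {..<b} :: real \<Rightarrow> complex)"
  define U where "U = transfer (phase c k) g"
  define L where "L = (if k = 0 then complex_of_real b else 0)"
  have [measurable]: "g \<in> borel_measurable borel" by (simp add: g_def)
  have [measurable]: "U n \<in> borel_measurable borel" for n
    unfolding U_def by measurable
  have g: "norm (g x) \<le> 1" for x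
    by (simp add: g_def indicator_def)
  have U1: "norm (U n x) \<le> 1" for n x
    unfolding U_def by (rule norm_transfer_le) (auto simp: g)
  have "AE y in unit_lebesgue. (\<lambda>n. U n y) \<longlonglongrightarrow> L"
  proof (cases "k = 0")
    case True
    then show ?thesis
      unfolding U_def g_def L_def by (intro AE_I2) (simp add: transfer_1_tendsto b)
  next
    case False
    then show ?thesis
      unfolding U_def g_def L_def using transfer_phase_tendsto_0[OF c] by simp
  qed
  then have "AE y in unit_lebesgue. (\<lambda>n. indicator X y * U n y) \<longlonglongrightarrow> indicator X y * L"
    by eventually_elim (rule tendsto_mult_left)
  then have "(\<lambda>n. \<integral>y. indicator X y * U n y \<partial>unit_lebesgue) \<longlonglongrightarrow> (\<integral>y. indicator X y * L \<partial>unit_lebesgue)"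
    by (intro integral_dominated_convergence[where w = "\<lambda>_. 1"] borel_measurable_unit_lebesgue)
      (auto simp: norm_mult indicator_def U1)
  moreover have "(\<integral>y. indicator X y * U n y \<partial>unit_lebesgue) =
      (\<integral>x. indicator X ((doubling ^^ n) x) * cis (k * birkhoff c n x) * indicator {..<b} x \<partial>unit_lebesgue)" for n
    unfolding U_def prod_phase[symmetric] g_def[symmetric]
    by (rule integral_doubling_transfer[symmetric, where B = 1]) (auto simp: g indicator_def)
  moreover have "(\<integral>y. indicator X y * L \<partial>unit_lebesgue) =
      (if k = 0 then of_real (measure unit_lebesgue (X \<inter> {0..<1}) * b) else 0)"
    by (simp add: L_def integral_unit_lebesgue_indicator)
  ultimately show ?thesis by simp
qed

section \<open>From characters to continuous functions on the circle\<close>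

inductive trig_poly :: "(real \<Rightarrow> complex) \<Rightarrow> bool" where
  monomial: "trig_poly (\<lambda>s. a * cis (2 * pi * of_int k * s))"
| add: "trig_poly f \<Longrightarrow> trig_poly g \<Longrightarrow> trig_poly (\<lambda>s. f s + g s)"

lemma trig_poly_const: "trig_poly (\<lambda>s. a)"
  using trig_poly.monomial[of a 0] by simp

lemma trig_poly_mult:
  assumes "trig_poly f" "trig_poly g"
  shows "trig_poly (\<lambda>s. f s * g s)"
  using assms
proof (induction arbitrary: g)
  case (monomial a k)
  from monomial show ?case
  proof (induction)
    case (monomial a' k')
    then show ?case
      using trig_poly.monomial[of "a * a'" "k + k'"]
      by (simp add: cis_mult[symmetric] distrib_left distrib_right mult_ac)
  next
    case (add f g)
    then show ?case
      using trig_poly.add by (fastforce simp: distrib_left)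
  qed
next
  case (add f1 f2)
  then show ?case
    using trig_poly.add by (fastforce simp: distrib_right)
qed

text \<open>Links the polynomials of the Stone-Weierstrass theorem to Fourier modes: on the circle a
  real-linear functional combines \<open>cos\<close> and \<open>sin\<close>, and trigonometric
  polynomials are closed under sums and products.\<close>

lemma trig_poly_real_polynomial:
  assumes "real_polynomial_function (p :: complex \<Rightarrow> real)"
  shows "trig_poly (\<lambda>s. of_real (p (cis (2 * pi * s))))"
  using assms
proof induction
  case (linear f)
  interpret f: bounded_linear f by fact
  \<comment> \<open>Euler's formulas give the coefficients \<open>a\<close> and \<open>a'\<close>
    for \<open>cos t * f 1 + sin t * f \<i>\<close>.\<close>
  define a where "a = (of_real (f 1) - \<i> * of_real (f \<i>)) / 2"
  define a' where "a' = (of_real (f 1) + \<i> * of_real (f \<i>)) / 2"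
  have "f (cis t) = cos t * f 1 + sin t * f \<i>" for t
  proof -
    have "cis t = cos t *\<^sub>R 1 + sin t *\<^sub>R \<i>"
      by (simp add: complex_eq_iff)
    then show ?thesis
      by (simp add: f.add f.scaleR)
  qed
  then have "complex_of_real (f (cis t)) = a * cis t + a' * cis (- t)" for t
    by (simp add: a_def a'_def complex_eq_iff algebra_simps add_divide_distrib diff_divide_distrib)
  then show ?case
    using trig_poly.add[OF trig_poly.monomial[of a 1] trig_poly.monomial[of a' "-1"]] by simp
next
  case (add f g)
  then show ?case using trig_poly.add by fastforce
next
  case (mult f g)
  then show ?case using trig_poly_mult by fastforce
qed (rule trig_poly_const)

lemma trig_poly_continuous: "trig_poly f \<Longrightarrow> continuous_on UNIV f"
  by (induction rule: trig_poly.induct) (intro continuous_intros; assumption)+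

lemma trig_poly_bounded: "trig_poly f \<Longrightarrow> \<exists>B. \<forall>s. norm (f s) \<le> B"
proof (induction rule: trig_poly.induct)
  case (monomial a k)
  show ?case by (rule exI[of _ "norm a"]) (simp add: norm_mult)
next
  case (add f g)
  then obtain A B where "norm (f s) \<le> A" "norm (g s) \<le> B" for s by blast
  then have "norm (f s + g s) \<le> A + B" for s by (meson norm_triangle_mono)
  then show ?case by blast
qed

text \<open>Rotation by \<open>1 / (2 * k)\<close> changes the sign of a nontrivial character but
  not its integral.\<close>

lemma integral_unit_lebesgue_cis:
  "(\<integral>s. cis (2 * pi * of_int k * s) \<partial>unit_lebesgue) = (if k = 0 then 1 else 0)"
proof (cases "k = 0")
  case True
  then show ?thesis using unit_lebesgue.prob_space by simp
next
  case False
  let ?f = "\<lambda>s. cis (2 * pi * of_int k * s)"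
  have I: "integrable unit_lebesgue ?f"
    by (rule integrable_unit_lebesgue_bounded[where B = 1]) auto
  have "?f (frac (s + 1 / (2 * of_int k))) = - ?f s" for s
  proof -
    have eq: "2 * pi * of_int k * frac (s + 1 / (2 * of_int k)) =
        2 * pi * of_int k * s + pi - 2 * pi * of_int (k * \<lfloor>s + 1 / (2 * of_int k)\<rfloor>)"
      using False by (simp add: frac_def field_simps)
    show ?thesis
      unfolding eq cis_divide[symmetric] cis_mult[symmetric] by (simp add: cis_multiple_2pi)
  qed
  then have "- integral\<^sup>L unit_lebesgue ?f = integral\<^sup>L unit_lebesgue ?f"
    using integral_rotate[OF I, of "1 / (2 * of_int k)"] by simp
  then show ?thesis using False by (simp add: eq_neg_iff_add_eq_0)
qed

text \<open>Only the mode \<open>k = 0\<close> survives in the limit, and its coefficient is the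
  integral of \<open>f\<close>; sums follow by linearity.\<close>

lemma trig_poly_correlation_tendsto:
  assumes c: "c > 0" and X [measurable]: "X \<in> sets borel" and b: "0 \<le> b" "b \<le> 1"
    and "trig_poly f"
  shows "(\<lambda>n. \<integral>x. indicator X ((doubling ^^ n) x) * f (birkhoff c n x) * indicator {..<b} x \<partial>unit_lebesgue)
     \<longlonglongrightarrow> of_real (measure unit_lebesgue (X \<inter> {0..<1}) * b) * integral\<^sup>L unit_lebesgue f"
  using \<open>trig_poly f\<close>
proof (induction rule: trig_poly.induct)
  case (monomial a k)
  have "(\<lambda>n. a * (\<integral>x. indicator X ((doubling ^^ n) x) * cis (2 * pi * of_int k * birkhoff c n x) * indicator {..<b} x \<partial>unit_lebesgue))
     \<longlonglongrightarrow> a * (if 2 * pi * of_int k = 0 then of_real (measure unit_lebesgue (X \<inter> {0..<1}) * b) else 0)"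
    by (intro tendsto_mult_left character_correlation_tendsto c X b)
  moreover have pull: "a * (\<integral>x. indicator X ((doubling ^^ n) x) * cis (2 * pi * of_int k * birkhoff c n x) * indicator {..<b} x \<partial>unit_lebesgue)
      = (\<integral>x. indicator X ((doubling ^^ n) x) * (a * cis (2 * pi * of_int k * birkhoff c n x)) * indicator {..<b} x \<partial>unit_lebesgue)" for n
    by (subst integral_mult_right_zero[symmetric]) (simp add: mult_ac)
  moreover have mean: "(\<integral>s. a * cis (2 * pi * of_int k * s) \<partial>unit_lebesgue) = a * (if k = 0 then 1 else 0)"
    by (simp only: integral_mult_right_zero integral_unit_lebesgue_cis)
  ultimately show ?case
    unfolding mean by (cases "k = 0") (simp_all add: mult.commute)
next
  case (add f g)
  have I: "integrable unit_lebesgue (\<lambda>x. indicator X ((doubling ^^ n) x) * h (birkhoff c n x) * indicator {..<b} x)"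
    "integrable unit_lebesgue h"
    if h: "trig_poly h" for h n
  proof -
    have [measurable]: "h \<in> borel_measurable borel"
      by (intro borel_measurable_continuous_onI trig_poly_continuous h)
    obtain B where B: "norm (h s) \<le> B" for s using trig_poly_bounded[OF h] by blast
    then have "0 \<le> B" using norm_ge_zero order_trans by blast
    then show "integrable unit_lebesgue (\<lambda>x. indicator X ((doubling ^^ n) x) * h (birkhoff c n x) * indicator {..<b} x)"
      by (intro integrable_unit_lebesgue_bounded[where B = B]) (measurable, auto simp: norm_mult indicator_def B)
    show "integrable unit_lebesgue h"
      by (rule integrable_unit_lebesgue_bounded[OF _ B]) measurable
  qed
  show ?case
    using tendsto_add[OF add.IH] add.hyps I by (simp add: distrib_left distrib_right)
qed

text \<open>Uniform approximation by a polynomial within \<open>e / 3\<close> moves the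
  correlations, for all \<open>n\<close> at once, and the limit by at most \<open>e / 3\<close>.
  Placing \<open>h\<close> on the circle builds in periodicity in the Birkhoff sum.\<close>

theorem circle_correlation_tendsto:
  fixes h :: "complex \<Rightarrow> real"
  assumes c: "c > 0" and X [measurable]: "X \<in> sets borel" and b: "0 \<le> b" "b \<le> 1"
    and h: "continuous_on (sphere 0 1) h"
  shows "(\<lambda>n. \<integral>x. indicator X ((doubling ^^ n) x) * h (cis (2 * pi * birkhoff c n x)) * indicator {..<b} x \<partial>unit_lebesgue)
     \<longlonglongrightarrow> measure unit_lebesgue (X \<inter> {0..<1}) * b * (\<integral>s. h (cis (2 * pi * s)) \<partial>unit_lebesgue)"
proof -
  define E where "E = (\<lambda>(f :: complex \<Rightarrow> real) n. \<integral>x. indicator X ((doubling ^^ n) x) * f (cis (2 * pi * birkhoff c n x)) * indicator {..<b} x \<partial>unit_lebesgue)"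
  define m where "m = measure unit_lebesgue (X \<inter> {0..<1}) * b"
  define mean where "mean = (\<lambda>f :: complex \<Rightarrow> real. \<integral>s. f (cis (2 * pi * s)) \<partial>unit_lebesgue)"
  have m: "0 \<le> m" "m \<le> 1"
    using b unit_lebesgue.prob_le_1 by (auto simp: m_def intro: mult_le_one)
  have cis_sphere: "cis t \<in> sphere 0 1" for t by simp
  have meas: "(\<lambda>s. f (cis s)) \<in> borel_measurable borel" if "continuous_on (sphere 0 1) f" for f :: "complex \<Rightarrow> real"
    by (intro borel_measurable_continuous_onI continuous_on_compose2[OF that] continuous_intros) auto
  have bounded: "\<exists>B. \<forall>s. \<bar>f (cis s)\<bar> \<le> B" if f: "continuous_on (sphere 0 1) f" for f :: "complex \<Rightarrow> real"
  proof -
    have "bounded (f ` sphere 0 1)"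
      by (intro compact_imp_bounded compact_continuous_image f) simp
    then obtain B where "\<forall>x\<in>f ` sphere 0 1. norm x \<le> B"
      unfolding bounded_iff by blast
    then have "\<bar>f (cis s)\<bar> \<le> B" for s
      using cis_sphere[of s] by auto
    then show ?thesis by blast
  qed
  have I: "integrable unit_lebesgue (\<lambda>x. indicator X ((doubling ^^ n) x) * f (cis (2 * pi * birkhoff c n x)) * indicator {..<b} x)"
    "integrable unit_lebesgue (\<lambda>s. f (cis (2 * pi * s)))"
    if f: "continuous_on (sphere 0 1) f" for f :: "complex \<Rightarrow> real" and n
  proof -
    note [measurable] = meas[OF f]
    obtain B where B: "\<And>s. \<bar>f (cis s)\<bar> \<le> B" using bounded[OF f] by blast
    then have "0 \<le> B" using abs_ge_zero order_trans by blast
    then show "integrable unit_lebesgue (\<lambda>x. indicator X ((doubling ^^ n) x) * f (cis (2 * pi * birkhoff c n x)) * indicator {..<b} x)"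
      by (intro integrable_unit_lebesgue_bounded[where B = B]) (measurable, auto simp: indicator_def B)
    show "integrable unit_lebesgue (\<lambda>s. f (cis (2 * pi * s)))"
      by (intro integrable_unit_lebesgue_bounded[where B = B]) (measurable, auto simp: B)
  qed
  have "(\<lambda>n. E h n) \<longlonglongrightarrow> m * mean h"
  proof (rule LIMSEQ_I)
    fix e :: real assume e: "0 < e"
    obtain p where p: "real_polynomial_function p" and close: "\<And>x. x \<in> sphere 0 1 \<Longrightarrow> \<bar>h x - p x\<bar> < e / 3"
      using Stone_Weierstrass_real_polynomial_function[OF compact_sphere h, of "e / 3"] e by auto
    have pc: "continuous_on (sphere 0 1) p"
      by (simp add: continuous_at_imp_continuous_on continuous_real_polymonial_function p)
    have "(\<lambda>n. complex_of_real (E p n)) \<longlonglongrightarrow> of_real (m * mean p)"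
      using trig_poly_correlation_tendsto[OF c X b trig_poly_real_polynomial[OF p]]
      unfolding E_def mean_def m_def integral_complex_of_real[symmetric] of_real_mult of_real_indicator .
    then have "(\<lambda>n. E p n) \<longlonglongrightarrow> m * mean p"
      by (simp only: tendsto_of_real_iff)
    then obtain N where N: "\<And>n. n \<ge> N \<Longrightarrow> norm (E p n - m * mean p) < e / 3"
      using LIMSEQ_D[of "E p" "m * mean p" "e / 3"] e by auto
    have close_E: "\<bar>E h n - E p n\<bar> \<le> e / 3" for n
    proof -
      define d where "d = (\<lambda>x. indicator X ((doubling ^^ n) x) * (h (cis (2 * pi * birkhoff c n x))
          - p (cis (2 * pi * birkhoff c n x))) * indicat_real {..<b} x)"
      have d_eq: "d = (\<lambda>x. indicator X ((doubling ^^ n) x) * h (cis (2 * pi * birkhoff c n x)) * indicator {..<b} x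
          - indicator X ((doubling ^^ n) x) * p (cis (2 * pi * birkhoff c n x)) * indicator {..<b} x)"
        unfolding d_def by (simp add: fun_eq_iff left_diff_distrib right_diff_distrib)
      have d_int: "integrable unit_lebesgue d"
        unfolding d_eq by (rule Bochner_Integration.integrable_diff[OF I(1)[OF h] I(1)[OF pc]])
      have d_le: "norm (d x) \<le> e / 3" for x
        using close[OF cis_sphere[of "2 * pi * birkhoff c n x"]] e by (simp add: d_def indicator_def)
      have "E h n - E p n = integral\<^sup>L unit_lebesgue d"
        unfolding E_def d_eq by (rule Bochner_Integration.integral_diff[OF I(1)[OF h] I(1)[OF pc], symmetric])
      also have "norm \<dots> \<le> (\<integral>x. norm (d x) \<partial>unit_lebesgue)"
        by (rule integral_norm_bound)
      also have "\<dots> \<le> e / 3"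
        by (intro unit_lebesgue.integral_le_const AE_I2 integrable_norm d_int d_le)
      finally show ?thesis by simp
    qed
    have close_mean: "\<bar>m * mean h - m * mean p\<bar> \<le> e / 3"
    proof -
      define d where "d = (\<lambda>s. h (cis (2 * pi * s)) - p (cis (2 * pi * s)))"
      have d_int: "integrable unit_lebesgue d"
        unfolding d_def by (rule Bochner_Integration.integrable_diff[OF I(2)[OF h] I(2)[OF pc]])
      have d_le: "norm (d s) \<le> e / 3" for s
        using close[OF cis_sphere[of "2 * pi * s"]] by (simp add: d_def)
      have "mean h - mean p = integral\<^sup>L unit_lebesgue d"
        unfolding mean_def d_def by (rule Bochner_Integration.integral_diff[OF I(2)[OF h] I(2)[OF pc], symmetric])
      also have "norm \<dots> \<le> (\<integral>s. norm (d s) \<partial>unit_lebesgue)"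
        by (rule integral_norm_bound)
      also have "\<dots> \<le> e / 3"
        by (intro unit_lebesgue.integral_le_const AE_I2 integrable_norm d_int d_le)
      finally have "\<bar>mean h - mean p\<bar> \<le> e / 3" by simp
      then have "m * \<bar>mean h - mean p\<bar> \<le> 1 * (e / 3)"
        using m by (intro mult_mono) auto
      then show ?thesis
        using m by (simp add: right_diff_distrib[symmetric] abs_mult)
    qed
    have "norm (E h n - m * mean h) < e" if "n \<ge> N" for n
    proof -
      have "\<bar>E h n - m * mean h\<bar> \<le> \<bar>E h n - E p n\<bar> + \<bar>E p n - m * mean p\<bar> + \<bar>m * mean h - m * mean p\<bar>"
        by linarith
      then show ?thesis
        using N[OF that] close_E[of n] close_mean
        by simp
    qed
    then show "\<exists>N. \<forall>n\<ge>N. norm (E h n - m * mean h) < e" by blast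
  qed
  then show ?thesis
    by (simp add: E_def m_def mean_def)
qed

section \<open>Mixing, generators and completion\<close>

lemma measurable_funpow: "f \<in> measurable M M \<Longrightarrow> f ^^ n \<in> measurable M M"
  by (induction n) (auto intro: measurable_comp)

lemma measure_preserving_measurable: "measure_preserving M f \<Longrightarrow> f \<in> measurable M M"
  by (simp add: measure_preserving_def)

lemma measure_preserving_funpow:
  assumes "measure_preserving M f"
  shows "measure_preserving M (f ^^ n)"
proof (induction n)
  case 0
  then show ?case
    by (auto simp: measure_preserving_def id_def dest: sets.sets_into_space intro!: arg_cong[where f = "emeasure M"])
next
  case (Suc n)
  have f: "f \<in> measurable M M" and fn: "f ^^ n \<in> measurable M M"
    using assms Suc by (auto simp: measure_preserving_def)
  show ?case
    unfolding measure_preserving_def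
  proof (intro conjI ballI)
    show "f ^^ Suc n \<in> measurable M M"
      by (rule measurable_funpow[OF f])
    fix A assume A: "A \<in> sets M"
    have "(f ^^ Suc n) -` A \<inter> space M = (f ^^ n) -` (f -` A \<inter> space M) \<inter> space M"
      using measurable_space[OF fn] by auto
    also have "emeasure M \<dots> = emeasure M (f -` A \<inter> space M)"
      using Suc measurable_sets[OF f A] unfolding measure_preserving_def by blast
    also have "\<dots> = emeasure M A"
      using assms A unfolding measure_preserving_def by blast
    finally show "emeasure M ((f ^^ Suc n) -` A \<inter> space M) = emeasure M A" .
  qed
qed

text \<open>Tannery's theorem, in the form that exchanges the time limit with a countable disjoint
  union.\<close>

lemma tendsto_suminf_dominated:
  fixes a :: "nat \<Rightarrow> nat \<Rightarrow> real"
  assumes "\<And>i. (\<lambda>n. a i n) \<longlonglongrightarrow> b i" "\<And>i n. norm (a i n) \<le> M i" "summable M"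
  shows "(\<lambda>n. \<Sum>i. a i n) \<longlonglongrightarrow> (\<Sum>i. b i)"
proof -
  have "\<forall>\<^sub>F (i, n) in at_top \<times>\<^sub>F sequentially. norm (a i n) \<le> M i"
    using assms(2) by (intro always_eventually) auto
  from tannerys_theorem[OF assms(1) this assms(3)] show ?thesis by simp
qed

text \<open>For one set fixed, the sets that satisfy the mixing limit with it form a Dynkin system:
  for a disjoint union the sums converge uniformly in the time because the map preserves measure.\<close>

lemma correlation_tendsto_sigma_sets:
  assumes "prob_space M" and f: "measure_preserving M f"
    and E: "Int_stable E" "sets M = sigma_sets (space M) E"
    and gen: "\<And>A B. A \<in> E \<Longrightarrow> B \<in> E \<Longrightarrow>
      (\<lambda>n. measure M ((f ^^ n) -` A \<inter> B)) \<longlonglongrightarrow> measure M A * measure M B"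
    and A: "A \<in> sets M" and B: "B \<in> sets M"
  shows "(\<lambda>n. measure M ((f ^^ n) -` A \<inter> B)) \<longlonglongrightarrow> measure M A * measure M B"
proof -
  interpret prob_space M by fact
  have fn [measurable]: "f ^^ n \<in> measurable M M" for n
    using f by (intro measurable_funpow measure_preserving_measurable)
  have fA: "(f ^^ n) -` A \<inter> space M \<in> sets M" if "A \<in> sets M" for A n
    using that by measurable
  have preserve: "measure M ((f ^^ n) -` A \<inter> space M) = measure M A" if "A \<in> sets M" for A n
    using measure_preserving_funpow[OF f, of n] that
    by (simp add: measure_preserving_def measure_def)
  have inter: "(f ^^ n) -` A \<inter> B = ((f ^^ n) -` A \<inter> space M) \<inter> B" if "B \<in> sets M" for A B n
    using sets.sets_into_space[OF that] by auto
  have fAB: "(f ^^ n) -` A \<inter> B \<in> sets M" if "A \<in> sets M" "B \<in> sets M" for A B n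
    unfolding inter[OF that(2)] by (intro sets.Int fA that)
  have E_sub: "E \<subseteq> Pow (space M)"
    using E(2) sets.sets_into_space by (auto intro: sigma_sets.Basic)
  have E_sets: "A \<in> sets M" if "A \<in> E" for A
    using that E(2) by (auto intro: sigma_sets.Basic)
  let ?P = "\<lambda>A B. (\<lambda>n. measure M ((f ^^ n) -` A \<inter> B)) \<longlonglongrightarrow> measure M A * measure M B"
  \<comment> \<open>First \<open>B\<close> is extended from the generator with \<open>A\<close>
    fixed in it; afterwards \<open>A\<close> is extended with \<open>B\<close> arbitrary.\<close>
  have step: "?P A B" if A: "A \<in> E" and B: "B \<in> sets M" for A B
    using E(1) E_sub B[unfolded E(2)]
  proof (induction rule: sigma_sets_induct_disjoint)
    case (basic B)
    then show ?case using gen A by blast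
  next
    case (compl B)
    note B = compl(1)[unfolded E(2)[symmetric]]
    have "measure M ((f ^^ n) -` A \<inter> (space M - B)) = measure M A - measure M ((f ^^ n) -` A \<inter> B)" for n
    proof -
      have "(f ^^ n) -` A \<inter> (space M - B) = ((f ^^ n) -` A \<inter> space M) - ((f ^^ n) -` A \<inter> B)"
        by auto
      then show ?thesis
        using finite_measure_Diff[OF fA[OF E_sets[OF A]] fAB[OF E_sets[OF A] B], of n n]
          sets.sets_into_space[OF B] preserve[OF E_sets[OF A], of n] by auto
    qed
    moreover have "(\<lambda>n. measure M A - measure M ((f ^^ n) -` A \<inter> B)) \<longlonglongrightarrow> measure M A - measure M A * measure M B"
      by (intro tendsto_diff tendsto_const compl)
    ultimately show ?case
      using prob_compl[OF B] by (simp add: right_diff_distrib)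
  next
    case (union B)
    have Bs: "range B \<subseteq> sets M" using union(2) E(2) by simp
    then have Bi: "B i \<in> sets M" for i by auto
    have "(\<lambda>i. measure M ((f ^^ n) -` A \<inter> B i)) sums measure M (\<Union>i. (f ^^ n) -` A \<inter> B i)" for n
      using union(1) fAB[OF E_sets[OF A] Bi] by (intro finite_measure_UNION) (auto simp: disjoint_family_on_def)
    then have eq: "measure M ((f ^^ n) -` A \<inter> (\<Union>i. B i)) = (\<Sum>i. measure M ((f ^^ n) -` A \<inter> B i))" for n
      by (simp add: sums_iff)
    have B_sums: "(\<lambda>i. measure M (B i)) sums measure M (\<Union>i. B i)"
      using finite_measure_UNION[OF Bs union(1)] .
    have "(\<lambda>n. \<Sum>i. measure M ((f ^^ n) -` A \<inter> B i)) \<longlonglongrightarrow> (\<Sum>i. measure M A * measure M (B i))"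
      using union(3) Bi sums_summable[OF B_sums]
      by (intro tendsto_suminf_dominated[where M = "\<lambda>i. measure M (B i)"]) (auto intro!: finite_measure_mono)
    then show ?case
      unfolding eq using sums_mult[OF B_sums, of "measure M A"] by (simp add: sums_iff)
  qed simp
  show ?thesis
    using E(1) E_sub A[unfolded E(2)]
  proof (induction rule: sigma_sets_induct_disjoint)
    case (basic A)
    then show ?case using step B by blast
  next
    case (compl A)
    note A = compl(1)[unfolded E(2)[symmetric]]
    have "measure M ((f ^^ n) -` (space M - A) \<inter> B) = measure M B - measure M ((f ^^ n) -` A \<inter> B)" for n
    proof -
      have "(f ^^ n) -` (space M - A) \<inter> B = B - ((f ^^ n) -` A \<inter> B)"
        using sets.sets_into_space[OF B] measurable_space[OF fn, of _ n] by blast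
      then show ?thesis
        using finite_measure_Diff[OF B fAB[OF A B], of n] by auto
    qed
    moreover have "(\<lambda>n. measure M B - measure M ((f ^^ n) -` A \<inter> B)) \<longlonglongrightarrow> measure M B - measure M A * measure M B"
      by (intro tendsto_diff tendsto_const compl)
    ultimately show ?case
      using prob_compl[OF A] by (simp add: left_diff_distrib)
  next
    case (union A)
    have As: "range A \<subseteq> sets M" using union(2) E(2) by simp
    then have Ai: "A i \<in> sets M" for i by auto
    have "(\<lambda>i. measure M ((f ^^ n) -` A i \<inter> B)) sums measure M (\<Union>i. (f ^^ n) -` A i \<inter> B)" for n
      using union(1) fAB[OF Ai B] by (intro finite_measure_UNION) (auto simp: disjoint_family_on_def)
    moreover have "(f ^^ n) -` (\<Union>i. A i) \<inter> B = (\<Union>i. (f ^^ n) -` A i \<inter> B)" for n by auto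
    ultimately have eq: "measure M ((f ^^ n) -` (\<Union>i. A i) \<inter> B) = (\<Sum>i. measure M ((f ^^ n) -` A i \<inter> B))" for n
      by (simp add: sums_iff)
    have A_sums: "(\<lambda>i. measure M (A i)) sums measure M (\<Union>i. A i)"
      using finite_measure_UNION[OF As union(1)] .
    \<comment> \<open>Invariance supplies a bound independent of \<open>n\<close>; for unions in the
      other set monotonicity gave one.\<close>
    have le: "measure M ((f ^^ n) -` A i \<inter> B) \<le> measure M (A i)" for i n
      unfolding preserve[OF Ai, of n i, symmetric] inter[OF B]
      by (intro finite_measure_mono fA Ai) auto
    have "(\<lambda>n. \<Sum>i. measure M ((f ^^ n) -` A i \<inter> B)) \<longlonglongrightarrow> (\<Sum>i. measure M (A i) * measure M B)"
      using union(3) le sums_summable[OF A_sums]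
      by (intro tendsto_suminf_dominated[where M = "\<lambda>i. measure M (A i)"]) auto
    then show ?case
      unfolding eq using sums_mult2[OF A_sums, of "measure M B"] by (simp add: sums_iff)
  qed simp
qed

section \<open>Completions and modifications on null sets\<close>

lemma completion_restrict_space:
  assumes "\<Omega> \<in> sets M"
  shows "completion (restrict_space M \<Omega>) = restrict_space (completion M) \<Omega>"
proof (rule measure_eqI)
  let ?R = "restrict_space M \<Omega>"
  have R: "A \<in> sets ?R \<longleftrightarrow> A \<subseteq> \<Omega> \<and> A \<in> sets M" for A
    using assms by (simp add: sets_restrict_space_iff)
  have C: "A \<in> sets (restrict_space (completion M) \<Omega>) \<longleftrightarrow> A \<subseteq> \<Omega> \<and> A \<in> sets (completion M)" for A
    using assms by (simp add: sets_restrict_space_iff)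
  \<comment> \<open>Null sets of the restriction are the null sets of \<open>M\<close> inside
    \<open>\<Omega>\<close>, and a covering null set may be cut down to
    \<open>\<Omega>\<close>.\<close>
  have iff: "A \<in> sets (completion ?R) \<longleftrightarrow> A \<subseteq> \<Omega> \<and> A \<in> sets (completion M)" for A
  proof
    assume A: "A \<in> sets (completion ?R)"
    then obtain S N N' where "A = S \<union> N" "N \<subseteq> N'" "N' \<in> null_sets ?R" "S \<in> sets ?R"
      by (rule sets_completionE)
    then show "A \<subseteq> \<Omega> \<and> A \<in> sets (completion M)"
      using assms by (auto simp: R null_sets_restrict_space intro: sets_completionI)
  next
    assume A: "A \<subseteq> \<Omega> \<and> A \<in> sets (completion M)"
    then obtain S N N' where *: "A = S \<union> N" "N \<subseteq> N'" "N' \<in> null_sets M" "S \<in> sets M"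
      by (auto elim: sets_completionE)
    then have "N' \<inter> \<Omega> \<in> null_sets ?R"
      using assms by (auto simp: null_sets_restrict_space intro: null_set_Int2)
    then show "A \<in> sets (completion ?R)"
      using A * by (intro sets_completionI[of A S N "N' \<inter> \<Omega>" ?R]) (auto simp: R)
  qed
  then show "sets (completion ?R) = sets (restrict_space (completion M) \<Omega>)"
    using C by blast
  fix A assume A: "A \<in> sets (completion ?R)"
  then obtain S N N' where *: "A = S \<union> N" "N \<subseteq> N'" "N' \<in> null_sets ?R" "S \<in> sets ?R"
    by (rule sets_completionE)
  have "emeasure (completion ?R) A = emeasure (completion ?R) S"
    using * unfolding *(1) by (intro emeasure_Un_null_set) (auto simp: null_sets_completion_iff2)
  also have "\<dots> = emeasure M S"
    using *(4) assms R by (simp add: emeasure_restrict_space)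
  also have "\<dots> = emeasure (completion M) A"
    using * assms unfolding *(1)
    by (subst emeasure_Un_null_set) (auto simp: null_sets_completion_iff2 null_sets_restrict_space R)
  also have "\<dots> = emeasure (restrict_space (completion M) \<Omega>) A"
    using A iff assms by (simp add: emeasure_restrict_space)
  finally show "emeasure (completion ?R) A = emeasure (restrict_space (completion M) \<Omega>) A" .
qed

lemma completion_symmetric_difference:
  assumes "Y \<in> sets M" "Z \<in> null_sets M" "(X - Y) \<union> (Y - X) \<subseteq> Z"
  shows "X \<in> sets (completion M)" "emeasure (completion M) X = emeasure M Y"
proof -
  have X: "X = (Y - Z) \<union> (X \<inter> Z)" using assms(3) by auto
  have YZ: "Y - Z \<in> sets M" using assms by auto
  have XZ: "X \<inter> Z \<in> null_sets (completion M)"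
    using assms(2) by (auto simp: null_sets_completion_iff2)
  show "X \<in> sets (completion M)"
    by (subst X) (use YZ XZ in auto)
  have "emeasure (completion M) X = emeasure (completion M) (Y - Z)"
    by (subst X) (use YZ XZ in \<open>simp add: emeasure_Un_null_set\<close>)
  also have "\<dots> = emeasure M Y"
    using YZ assms by (simp add: emeasure_Diff_null_set)
  finally show "emeasure (completion M) X = emeasure M Y" .
qed

lemma AE_measure_preserving_funpow:
  assumes F: "measure_preserving M F" and P: "AE p in M. P p"
  shows "AE p in M. P ((F ^^ j) p)"
proof -
  have Fj: "measure_preserving M (F ^^ j)"
    by (rule measure_preserving_funpow[OF F])
  obtain N where N: "N \<in> null_sets M" "{p \<in> space M. \<not> P p} \<subseteq> N"
    using P by (auto simp: eventually_ae_filter)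
  have "(F ^^ j) -` N \<inter> space M \<in> null_sets M"
    using Fj N(1) measurable_sets[of "F ^^ j" M M N] by (auto simp: measure_preserving_def null_sets_def)
  moreover have "{p \<in> space M. \<not> P ((F ^^ j) p)} \<subseteq> (F ^^ j) -` N \<inter> space M"
    using N(2) measurable_space[OF measure_preserving_measurable[OF Fj]] by auto
  ultimately show ?thesis
    by (rule AE_I')
qed

text \<open>Almost every \<open>F\<close>-orbit avoids the null set where \<open>f\<close> and
  \<open>F\<close> differ, and along such an orbit the iterates coincide.\<close>

lemma AE_funpow_eq:
  assumes F: "measure_preserving M F" and eq: "AE p in M. f p = F p"
  shows "AE p in M. (f ^^ n) p = (F ^^ n) p"
proof -
  have "AE p in M. \<forall>j. f ((F ^^ j) p) = F ((F ^^ j) p)"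
    unfolding AE_all_countable by (intro allI AE_measure_preserving_funpow[OF F eq])
  then show ?thesis
  proof eventually_elim
    case (elim p)
    then show ?case by (induction n) auto
  qed
qed

text \<open>The preimages can differ only where \<open>g\<close> and \<open>G\<close> differ or
  where \<open>G\<close> hits a null set covering the null part of \<open>A\<close>; invariance
  makes the second set null.\<close>

lemma vimage_symmetric_difference:
  assumes g: "measure_preserving M G" and eq: "AE p in M. g p = G p"
    and A: "A \<in> sets (completion M)"
  obtains Z where "Z \<in> null_sets M"
    "((g -` A \<inter> space M) - (G -` main_part M A \<inter> space M)) \<union>
      ((G -` main_part M A \<inter> space M) - (g -` A \<inter> space M)) \<subseteq> Z"
proof -
  obtain D where D: "D \<in> null_sets M" "{p \<in> space M. g p \<noteq> G p} \<subseteq> D"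
    using eq by (auto simp: eventually_ae_filter)
  obtain N where N: "N \<in> null_sets M" "null_part M A \<subseteq> N"
    using null_part[OF A] by blast
  have "G -` N \<inter> space M \<in> null_sets M"
    using g N(1) measurable_sets[of G M M N] by (auto simp: measure_preserving_def null_sets_def)
  then have "D \<union> (G -` N \<inter> space M) \<in> null_sets M"
    using D(1) by auto
  moreover have "x \<in> main_part M A \<or> x \<in> N \<longleftrightarrow> x \<in> A \<or> x \<in> N" for x
    using main_part_null_part_Un[OF A] N(2) by blast
  then have "((g -` A \<inter> space M) - (G -` main_part M A \<inter> space M)) \<union>
      ((G -` main_part M A \<inter> space M) - (g -` A \<inter> space M)) \<subseteq> D \<union> (G -` N \<inter> space M)"
    using D(2) by fastforce
  ultimately show ?thesis by (rule that)
qed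

lemma measure_preserving_completion:
  assumes F: "measure_preserving M F" and eq: "AE p in M. f p = F p" and f: "f \<in> space M \<rightarrow> space M"
  shows "measure_preserving (completion M) f"
proof -
  have *: "f -` A \<inter> space M \<in> sets (completion M)"
    "emeasure (completion M) (f -` A \<inter> space M) = emeasure (completion M) A"
    if A: "A \<in> sets (completion M)" for A
  proof -
    obtain Z where Z: "Z \<in> null_sets M"
      "((f -` A \<inter> space M) - (F -` main_part M A \<inter> space M)) \<union>
        ((F -` main_part M A \<inter> space M) - (f -` A \<inter> space M)) \<subseteq> Z"
      using vimage_symmetric_difference[OF F eq A] .
    have "F -` main_part M A \<inter> space M \<in> sets M"
      using F A by (auto simp: measure_preserving_def intro: measurable_sets)
    note sd = completion_symmetric_difference[OF this Z]
    show "f -` A \<inter> space M \<in> sets (completion M)" by (rule sd(1))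
    show "emeasure (completion M) (f -` A \<inter> space M) = emeasure (completion M) A"
      using sd(2) F A by (simp add: measure_preserving_def)
  qed
  show ?thesis
    using * f by (auto simp: measure_preserving_def intro!: measurableI)
qed

text \<open>Up to null sets, sets of the completion may be replaced by their main parts and iterates
  of \<open>f\<close> by those of \<open>F\<close>; the correlations are then equal for each
  \<open>n\<close>.\<close>

lemma mixing_completion:
  assumes F: "mixing M F" and eq: "AE p in M. f p = F p" and f: "f \<in> space M \<rightarrow> space M"
  shows "mixing (completion M) f"
  unfolding mixing_def
proof (intro conjI ballI)
  interpret prob_space M using F by (simp add: mixing_def)
  have pres: "measure_preserving M F" using F by (simp add: mixing_def)
  show "prob_space (completion M)"
    by (rule prob_spaceI) (simp add: emeasure_space_1)
  show "measure_preserving (completion M) f"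
    by (rule measure_preserving_completion[OF pres eq f])
  fix A B assume A: "A \<in> sets (completion M)" and B: "B \<in> sets (completion M)"
  define S T where "S = main_part M A" and "T = main_part M B"
  have S: "S \<in> sets M" and T: "T \<in> sets M" using A B by (auto simp: S_def T_def)
  have "measure (completion M) ((f ^^ n) -` A \<inter> B) = measure M ((F ^^ n) -` S \<inter> T)" for n
  proof -
    have Fn: "measure_preserving M (F ^^ n)" by (rule measure_preserving_funpow[OF pres])
    obtain Z where Z: "Z \<in> null_sets M"
      "(((f ^^ n) -` A \<inter> space M) - ((F ^^ n) -` S \<inter> space M)) \<union>
        (((F ^^ n) -` S \<inter> space M) - ((f ^^ n) -` A \<inter> space M)) \<subseteq> Z"
      using vimage_symmetric_difference[OF Fn AE_funpow_eq[OF pres eq] A] unfolding S_def .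
    obtain N where N: "N \<in> null_sets M" "null_part M B \<subseteq> N"
      using null_part[OF B] by blast
    have "T \<union> null_part M B = B" unfolding T_def using B by simp
    moreover have "T \<subseteq> space M" "B \<subseteq> space M"
      using sets.sets_into_space[OF T] sets.sets_into_space[OF B] by auto
    ultimately have sub: "(((f ^^ n) -` A \<inter> B) - ((F ^^ n) -` S \<inter> T)) \<union>
        (((F ^^ n) -` S \<inter> T) - ((f ^^ n) -` A \<inter> B)) \<subseteq> Z \<union> N"
      using Z(2) N(2) by blast
    have "(F ^^ n) -` S \<inter> T = ((F ^^ n) -` S \<inter> space M) \<inter> T"
      using sets.sets_into_space[OF T] by auto
    moreover have "(F ^^ n) -` S \<inter> space M \<in> sets M"
      using Fn S by (auto simp: measure_preserving_def intro: measurable_sets)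
    ultimately have "(F ^^ n) -` S \<inter> T \<in> sets M"
      using T by auto
    moreover have "Z \<union> N \<in> null_sets M" using Z(1) N(1) by auto
    ultimately show ?thesis
      using completion_symmetric_difference(2)[OF _ _ sub] by (simp add: measure_def)
  qed
  moreover have "measure (completion M) A = measure M S" "measure (completion M) B = measure M T"
    using A B by (auto simp: measure_def S_def T_def)
  ultimately show "(\<lambda>n. measure (completion M) ((f ^^ n) -` A \<inter> B))
      \<longlonglongrightarrow> measure (completion M) A * measure (completion M) B"
    using F S T by (simp add: mixing_def)
qed

section \<open>The skew product on the torus\<close>

abbreviation unit_square :: "(real \<times> real) measure" where
  "unit_square \<equiv> unit_lebesgue \<Otimes>\<^sub>M unit_lebesgue"

interpretation unit_square: pair_prob_space unit_lebesgue unit_lebesgue ..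

lemma space_unit_square [simp]: "space unit_square = torus"
  by (simp add: space_pair_measure torus_def)

lemma unit_square_borel_measurable [measurable]:
  "fst \<in> borel_measurable unit_square" "snd \<in> borel_measurable unit_square"
proof -
  have "(\<lambda>x. x) \<in> measurable unit_lebesgue borel"
    by (rule borel_measurable_unit_lebesgue) simp
  from measurable_compose[OF measurable_fst this] measurable_compose[OF measurable_snd this]
  show "fst \<in> borel_measurable unit_square" "snd \<in> borel_measurable unit_square"
    by auto
qed

lemma sets_unit_square_iff: "A \<in> sets unit_square \<longleftrightarrow> A \<in> sets borel \<and> A \<subseteq> torus"
proof
  have "sets unit_square \<subseteq> sets (borel :: (real \<times> real) measure)"
    by (rule sets_pair_in_sets) (auto simp: sets_unit_lebesgue_iff intro: borel_Times)
  moreover assume "A \<in> sets unit_square"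
  ultimately show "A \<in> sets borel \<and> A \<subseteq> torus"
    using sets.sets_into_space[of A unit_square] by auto
next
  have "(\<lambda>p. (fst p, snd p)) \<in> measurable unit_square (borel \<Otimes>\<^sub>M borel)"
    by (intro measurable_Pair unit_square_borel_measurable)
  then have id: "(\<lambda>p. p) \<in> borel_measurable unit_square"
    by (simp add: borel_prod)
  assume "A \<in> sets borel \<and> A \<subseteq> torus"
  then show "A \<in> sets unit_square"
    using measurable_sets[OF id, of A] by (simp add: Int_absorb2)
qed

lemma torus_borel: "torus \<in> sets borel"
  unfolding torus_def by (intro borel_Times) auto

text \<open>Agreement on measurable rectangles determines the product measure. This links Fubini on
  the product to Lebesgue measure on the torus.\<close>

lemma unit_square_eq: "unit_square = restrict_space lborel torus"
proof (rule pair_measure_eqI)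
  show "sets unit_square = sets (restrict_space lborel torus)"
    using torus_borel by (auto simp: sets_unit_square_iff sets_restrict_space_iff)
  fix A B assume A: "A \<in> sets unit_lebesgue" and B: "B \<in> sets unit_lebesgue"
  have "A \<times> B \<subseteq> torus"
    using A B by (auto simp: torus_def sets_unit_lebesgue_iff)
  moreover have AB: "A \<in> sets lborel" "B \<in> sets lborel"
    using A B by (auto simp: sets_unit_lebesgue_iff)
  ultimately have "emeasure (restrict_space lborel torus) (A \<times> B) = emeasure lborel (A \<times> B)"
    using torus_borel by (intro emeasure_restrict_space) auto
  also have "\<dots> = emeasure lborel A * emeasure lborel B"
    using AB by (simp add: lborel_prod[symmetric] lborel.emeasure_pair_measure_Times)
  finally show "emeasure unit_lebesgue A * emeasure unit_lebesgue B = emeasure (restrict_space lborel torus) (A \<times> B)"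
    using A B by (simp add: emeasure_unit_lebesgue)
qed unfold_locales

lemma torus_lebesgue_eq: "torus_lebesgue = completion unit_square"
  unfolding unit_square_eq using torus_borel by (intro completion_restrict_space[symmetric]) simp

text \<open>Anchoring at the origin gives stability under intersection, and within the unit interval
  the sides are cut out by half-lines \<open>{..<b}\<close>, for which the transfer estimates
  hold.\<close>

definition corner_rectangles :: "(real \<times> real) set set" where
  "corner_rectangles = {{0..<a} \<times> {0..<b} | a b. 0 \<le> a \<and> a \<le> 1 \<and> 0 \<le> b \<and> b \<le> 1}"

lemma corner_rectanglesI:
  "0 \<le> a \<Longrightarrow> a \<le> 1 \<Longrightarrow> 0 \<le> b \<Longrightarrow> b \<le> 1 \<Longrightarrow> {0..<a} \<times> {0..<b} \<in> corner_rectangles"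
  unfolding corner_rectangles_def by blast

lemma corner_rectangles_sets: "A \<in> corner_rectangles \<Longrightarrow> A \<in> sets unit_square"
  by (auto simp: corner_rectangles_def sets_unit_lebesgue_iff)

lemma Int_stable_corner_rectangles: "Int_stable corner_rectangles"
proof (rule Int_stableI)
  fix A B assume "A \<in> corner_rectangles" "B \<in> corner_rectangles"
  then obtain a b a' b' where *: "A = {0..<a} \<times> {0..<b}" "B = {0..<a'} \<times> {0..<b'}"
    "0 \<le> a" "a \<le> 1" "0 \<le> b" "b \<le> 1" "0 \<le> a'" "a' \<le> 1" "0 \<le> b'" "b' \<le> 1"
    by (auto simp: corner_rectangles_def)
  have "A \<inter> B = {0..<min a a'} \<times> {0..<min b b'}"
    unfolding *(1,2) by auto
  also have "\<dots> \<in> corner_rectangles"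
    using *(3-) by (intro corner_rectanglesI) auto
  finally show "A \<inter> B \<in> corner_rectangles" .
qed

lemma sets_unit_square_corner_rectangles: "sets unit_square = sigma_sets torus corner_rectangles"
proof
  define S where "S = sigma torus corner_rectangles"
  have sub: "corner_rectangles \<subseteq> Pow torus"
    by (auto simp: corner_rectangles_def torus_def)
  have space_S: "space S = torus" using sub by (simp add: S_def space_measure_of)
  have sets_S: "sets S = sigma_sets torus corner_rectangles" using sub by (simp add: S_def)
  have rect: "{0..<a} \<times> {0..<b} \<in> sets S" if "0 \<le> a" "a \<le> 1" "0 \<le> b" "b \<le> 1" for a b :: real
    unfolding sets_S using that by (intro sigma_sets.Basic corner_rectanglesI)
  have "fst \<in> borel_measurable S"
    unfolding borel_measurable_iff_less
  proof
    fix a :: real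
    \<comment> \<open>Clipping \<open>a\<close> to \<open>[0, 1]\<close> makes every sublevel set of
      the coordinate a corner rectangle.\<close>
    have "{w \<in> space S. fst w < a} = {0..<min 1 (max 0 a)} \<times> {0..<1}"
      by (auto simp: space_S torus_def)
    then show "{w \<in> space S. fst w < a} \<in> sets S" by (simp add: rect)
  qed
  moreover have "snd \<in> borel_measurable S"
    unfolding borel_measurable_iff_less
  proof
    fix a :: real
    have "{w \<in> space S. snd w < a} = {0..<1} \<times> {0..<min 1 (max 0 a)}"
      by (auto simp: space_S torus_def)
    then show "{w \<in> space S. snd w < a} \<in> sets S" by (simp add: rect)
  qed
  ultimately have meas: "fst -` A \<inter> space S \<in> sets S" "snd -` A \<inter> space S \<in> sets S" if "A \<in> sets borel" for A
    using that by (auto intro: measurable_sets)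
  show "sets unit_square \<subseteq> sigma_sets torus corner_rectangles"
    unfolding sets_S[symmetric]
  proof (rule sets_pair_in_sets)
    fix A B assume "A \<in> sets unit_lebesgue" "B \<in> sets unit_lebesgue"
    then have AB: "A \<in> sets borel" "B \<in> sets borel" "A \<subseteq> {0..<1}" "B \<subseteq> {0..<1}"
      by (auto simp: sets_unit_lebesgue_iff)
    then have "A \<times> B = (fst -` A \<inter> space S) \<inter> (snd -` B \<inter> space S)"
      by (auto simp: space_S torus_def)
    then show "A \<times> B \<in> sets S"
      using meas AB by (metis sets.Int)
  qed
  show "sigma_sets torus corner_rectangles \<subseteq> sets unit_square"
    using sets.sigma_sets_subset[of corner_rectangles unit_square] corner_rectangles_sets by auto
qed

lemma measure_unit_square_sections:
  assumes A: "A \<in> sets unit_square"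
  shows "measure unit_square A = (\<integral>x. (\<integral>y. indicator A (x, y) \<partial>unit_lebesgue) \<partial>unit_lebesgue)"
proof -
  have "integrable unit_square (indicator A :: _ \<Rightarrow> real)"
    using A by (simp add: unit_square.emeasure_eq_measure)
  then have "(\<integral>x. (\<integral>y. indicat_real A (x, y) \<partial>unit_lebesgue) \<partial>unit_lebesgue) = (\<integral>p. indicat_real A p \<partial>unit_square)"
    by (rule unit_square.integral_fst')
  also have "\<dots> = measure unit_square A"
    using sets.sets_into_space[OF A] by (simp add: Int_absorb2)
  finally show ?thesis by simp
qed

section \<open>Invariance of the product measure\<close>

lemma doubling_measurable [measurable]: "doubling \<in> measurable unit_lebesgue unit_lebesgue"
  using doubling_range by (intro measurable_into_unit_lebesgue borel_measurable_unit_lebesgue) auto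

lemma integral_doubling:
  fixes g :: "real \<Rightarrow> real"
  assumes g: "g \<in> borel_measurable unit_lebesgue" "\<And>x. \<bar>g x\<bar> \<le> B"
  shows "(\<integral>x. g (doubling x) \<partial>unit_lebesgue) = integral\<^sup>L unit_lebesgue g"
proof -
  have "integrable unit_lebesgue (\<lambda>x. g (doubling x))"
    using g by (intro unit_lebesgue.integrable_const_bound[where B = B]) (auto intro: measurable_compose[OF doubling_measurable])
  from integral_branches[OF this]
  have "(\<integral>x. g (doubling x) \<partial>unit_lebesgue) = (1/2) *\<^sub>R ((\<integral>y. g (doubling (y / 2)) \<partial>unit_lebesgue)
      + (\<integral>y. g (doubling ((y + 1) / 2)) \<partial>unit_lebesgue))" .
  also have "(\<integral>y. g (doubling (y / 2)) \<partial>unit_lebesgue) = integral\<^sup>L unit_lebesgue g"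
    by (intro Bochner_Integration.integral_cong) (simp_all add: doubling_branches)
  also have "(\<integral>y. g (doubling ((y + 1) / 2)) \<partial>unit_lebesgue) = integral\<^sup>L unit_lebesgue g"
    by (intro Bochner_Integration.integral_cong) (simp_all add: doubling_branches)
  finally show ?thesis by simp
qed

text \<open>A total version of the map: at \<open>x = 1/2\<close> division by zero makes
  \<open>roof c\<close> equal to 0.\<close>

definition skew :: "real \<Rightarrow> real \<times> real \<Rightarrow> real \<times> real" where
  "skew c = (\<lambda>(x, y). (doubling x, frac (y + roof c x)))"

lemma skew_measurable: "skew c \<in> measurable unit_square unit_square"
proof -
  have "(\<lambda>p. frac (snd p + roof c (fst p))) \<in> measurable unit_square unit_lebesgue"
    by (rule measurable_into_unit_lebesgue) (measurable, simp add: frac_lt_1)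
  then show ?thesis
    unfolding skew_def split_beta' by measurable
qed

text \<open>By Fubini, the inner integral absorbs the rotation of the fibre and the outer one the
  doubling of the base.\<close>

lemma measure_preserving_skew: "measure_preserving unit_square (skew c)"
  unfolding measure_preserving_def
proof (intro conjI ballI skew_measurable)
  fix A assume A [measurable]: "A \<in> sets unit_square"
  define G where "G = (\<lambda>x. \<integral>y. indicat_real A (x, y) \<partial>unit_lebesgue)"
  have [measurable]: "G \<in> borel_measurable unit_lebesgue"
    unfolding G_def by measurable
  have sections: "integrable unit_lebesgue (\<lambda>y. indicat_real A (x, y))" for x
  proof (cases "x \<in> {0..<1}")
    case True
    then have "Pair x \<in> measurable unit_lebesgue unit_square"
      by (intro measurable_Pair1') simp
    from measurable_compose[OF this borel_measurable_indicator[OF A]]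
    have "(\<lambda>y. indicat_real A (x, y)) \<in> borel_measurable unit_lebesgue" .
    then show ?thesis
      by (intro unit_lebesgue.integrable_const_bound[where B = 1]) (auto simp: indicator_def)
  next
    case False
    then have "(\<lambda>y. indicat_real A (x, y)) = (\<lambda>y. 0)"
      using sets.sets_into_space[OF A] by (auto simp: fun_eq_iff indicator_def torus_def)
    then show ?thesis by simp
  qed
  have G: "\<bar>G x\<bar> \<le> 1" for x
  proof -
    have "0 \<le> G x" unfolding G_def by simp
    moreover have "G x \<le> 1"
      unfolding G_def by (intro unit_lebesgue.integral_le_const sections) simp
    ultimately show ?thesis by simp
  qed
  have "measure unit_square (skew c -` A \<inter> space unit_square)
      = (\<integral>x. (\<integral>y. indicator (skew c -` A \<inter> space unit_square) (x, y) \<partial>unit_lebesgue) \<partial>unit_lebesgue)"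
    by (intro measure_unit_square_sections measurable_sets[OF skew_measurable] A)
  also have "\<dots> = (\<integral>x. (\<integral>y. indicator A (doubling x, frac (y + roof c x)) \<partial>unit_lebesgue) \<partial>unit_lebesgue)"
    by (intro Bochner_Integration.integral_cong) (auto simp: indicator_def skew_def torus_def)
  also have "\<dots> = (\<integral>x. G (doubling x) \<partial>unit_lebesgue)"
    unfolding G_def by (intro Bochner_Integration.integral_cong integral_rotate sections refl)
  also have "\<dots> = integral\<^sup>L unit_lebesgue G"
    by (rule integral_doubling[OF _ G]) measurable
  also have "\<dots> = measure unit_square A"
    unfolding G_def by (rule measure_unit_square_sections[OF A, symmetric])
  finally show "emeasure unit_square (skew c -` A \<inter> space unit_square) = emeasure unit_square A"
    by (simp add: unit_square.emeasure_eq_measure)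
qed

section \<open>Iterates of the skew product and overlaps of rotated arcs\<close>

lemma frac_add_frac: "frac (frac a + b) = frac (a + b :: real)"
proof -
  have "frac (frac a + b) = frac (a + b - of_int \<lfloor>a\<rfloor>)"
    by (rule arg_cong[where f = frac]) (simp add: frac_def)
  also have "\<dots> = frac (a + b)"
    by (simp only: frac_def floor_diff_of_int)
  finally show ?thesis .
qed

text \<open>Fractional parts taken at every step can be postponed to the end. The range of
  \<open>y\<close> enters at \<open>n = 0\<close>, where \<open>frac y\<close> must be
  \<open>y\<close>.\<close>

lemma skew_funpow:
  assumes "y \<in> {0..<1}"
  shows "(skew c ^^ n) (x, y) = ((doubling ^^ n) x, frac (y + birkhoff c n x))"
proof (induction n)
  case 0
  then show ?case using assms by (simp add: birkhoff_def frac_eq)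
next
  case (Suc n)
  then show ?case
    by (simp add: skew_def frac_add_frac birkhoff_def add.assoc)
qed

text \<open>A function of a point on the circle rather than of an angle, so that approximation on
  the compact circle applies. For \<open>w = cis (2 * pi * s)\<close> it measures the
  \<open>y < d\<close> in the unit interval with \<open>frac (y + s) < e\<close>.\<close>

definition rotation_overlap :: "real \<Rightarrow> real \<Rightarrow> complex \<Rightarrow> real" where
  "rotation_overlap d e w =
    (\<integral>y. indicat_real {..<d} y * indicat_real {..<2 * pi * e} (Arg2pi (w * cis (2 * pi * y))) \<partial>unit_lebesgue)"

lemma Arg2pi_cis_frac: "Arg2pi (cis (2 * pi * t)) = 2 * pi * frac t"
proof (rule Arg2pi_unique[of 1])
  have "2 * pi * t = 2 * pi * frac t + 2 * pi * of_int \<lfloor>t\<rfloor>"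
    by (simp add: frac_def algebra_simps)
  then have "cis (2 * pi * t) = cis (2 * pi * frac t)"
    by (metis cis_mult cis_multiple_2pi Ints_of_int mult.right_neutral)
  then show "of_real 1 * exp (\<i> * of_real (2 * pi * frac t)) = cis (2 * pi * t)"
    by (simp add: cis_conv_exp)
qed (auto simp: frac_lt_1)

lemma rotation_overlap_cis:
  "rotation_overlap d e (cis (2 * pi * s)) =
    (\<integral>y. indicat_real {..<d} y * indicat_real {..<e} (frac (y + s)) \<partial>unit_lebesgue)"
proof -
  have "Arg2pi (cis (2 * pi * s) * cis (2 * pi * y)) = 2 * pi * frac (y + s)" for y
    using Arg2pi_cis_frac[of "y + s"] by (simp add: cis_mult distrib_left add.commute)
  then show ?thesis
    unfolding rotation_overlap_def by (simp add: indicator_def)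
qed

lemma sphere_cis:
  fixes w :: complex
  assumes "w \<in> sphere 0 1"
  obtains s where "w = cis (2 * pi * s)"
proof -
  have "w = cis (2 * pi * (Arg w / (2 * pi)))"
    using assms cis_Arg[of w] by (simp add: sgn_eq) (metis cis_Arg div_by_1 norm_zero of_real_1 sgn_eq zero_neq_one)
  then show ?thesis by (rule that)
qed

lemma AE_frac_add_neq:
  "AE y in unit_lebesgue. frac (y + s) \<noteq> t"
proof -
  have "{y \<in> {0..<1}. frac (y + s) = t} \<subseteq> {frac (t - s)}"
  proof
    fix y assume y: "y \<in> {y \<in> {0..<1}. frac (y + s) = t}"
    then have "t - s = y - of_int \<lfloor>y + s\<rfloor>" by (auto simp: frac_def)
    then have "frac (t - s) = frac y" by (simp add: frac_def)
    then show "y \<in> {frac (t - s)}" using y by (simp add: frac_eq)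
  qed
  moreover have "{frac (t - s)} \<in> null_sets unit_lebesgue"
    by (auto simp: null_sets_def emeasure_unit_lebesgue sets_unit_lebesgue_iff frac_lt_1)
  ultimately show ?thesis
    by (intro AE_I'[of "{frac (t - s)}"]) auto
qed

text \<open>At each point \<open>w\<close> of the circle the integrand is continuous for almost
  every \<open>y\<close>, and dominated convergence passes this to the integral.\<close>

lemma rotation_overlap_continuous: "continuous_on (sphere 0 1) (rotation_overlap d e)"
  unfolding continuous_on_sequentially
proof (intro allI ballI impI, elim conjE)
  fix u and w :: complex assume w: "w \<in> sphere 0 1" and u: "\<forall>n. u n \<in> sphere 0 1" and lim: "u \<longlonglongrightarrow> w"
  obtain s where s: "w = cis (2 * pi * s)" using sphere_cis[OF w] .
  have "\<exists>s'. u n = cis (2 * pi * s')" for n using sphere_cis[of "u n"] u by blast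
  then obtain t where t: "\<And>n. u n = cis (2 * pi * t n)" by metis
  define F where "F = (\<lambda>v y. indicat_real {..<d} y * indicat_real {..<2 * pi * e} (Arg2pi (v * cis (2 * pi * y))))"
  have F_cis: "F (cis (2 * pi * r)) = (\<lambda>y. indicat_real {..<d} y * indicat_real {..<e} (frac (y + r)))" for r
  proof
    fix y show "F (cis (2 * pi * r)) y = indicat_real {..<d} y * indicat_real {..<e} (frac (y + r))"
      using Arg2pi_cis_frac[of "y + r"] by (simp add: F_def indicator_def cis_mult distrib_left add.commute)
  qed
  have meas: "F (cis (2 * pi * r)) \<in> borel_measurable unit_lebesgue" for r
    unfolding F_cis by (rule borel_measurable_unit_lebesgue) measurable
  \<comment> \<open>The excluded fractional parts are 0, the cut of \<open>Arg2pi\<close>, and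
    \<open>e\<close>, the edge of the indicator.\<close>
  have "AE y in unit_lebesgue. (\<lambda>n. F (u n) y) \<longlonglongrightarrow> F w y"
    using AE_frac_add_neq[of s 0] AE_frac_add_neq[of s e]
  proof eventually_elim
    case (elim y)
    let ?z = "w * cis (2 * pi * y)"
    have Arg: "Arg2pi ?z = 2 * pi * frac (y + s)"
      using Arg2pi_cis_frac[of "y + s"] by (simp add: s cis_mult distrib_left add.commute)
    have "?z \<notin> \<real>\<^sub>\<ge>\<^sub>0"
      using Arg elim(1) Arg2pi_eq_0[of ?z] by (auto simp: complex_nonneg_Reals_iff complex_is_Real_iff)
    then have "isCont Arg2pi ?z" by (rule continuous_at_Arg2pi)
    moreover have "(\<lambda>n. u n * cis (2 * pi * y)) \<longlonglongrightarrow> ?z"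
      by (intro tendsto_mult lim tendsto_const)
    ultimately have A: "(\<lambda>n. Arg2pi (u n * cis (2 * pi * y))) \<longlonglongrightarrow> 2 * pi * frac (y + s)"
      using isCont_tendsto_compose Arg by metis
    have "\<forall>\<^sub>F n in sequentially. indicat_real {..<2 * pi * e} (Arg2pi (u n * cis (2 * pi * y)))
        = indicat_real {..<2 * pi * e} (Arg2pi ?z)"
    proof (cases "frac (y + s) < e")
      case True
      then have "2 * pi * frac (y + s) < 2 * pi * e" by simp
      from order_tendstoD(2)[OF A this] show ?thesis
        by eventually_elim (simp add: Arg True)
    next
      case False
      then have "2 * pi * e < 2 * pi * frac (y + s)" using elim(2) by simp
      from order_tendstoD(1)[OF A this] show ?thesis
        by eventually_elim (use False in \<open>simp add: Arg\<close>)
    qed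
    then have "\<forall>\<^sub>F n in sequentially. F (u n) y = F w y"
      by eventually_elim (simp add: F_def)
    then show ?case by (rule tendsto_eventually)
  qed
  then have "(\<lambda>n. integral\<^sup>L unit_lebesgue (F (u n))) \<longlonglongrightarrow> integral\<^sup>L unit_lebesgue (F w)"
    using meas by (intro integral_dominated_convergence[where w = "\<lambda>_. 1"]) (auto simp: t s F_def indicator_def)
  then show "(rotation_overlap d e \<circ> u) \<longlonglongrightarrow> rotation_overlap d e w"
    by (simp add: rotation_overlap_def F_def comp_def)
qed

text \<open>Fubini: for each fixed \<open>y\<close> the second indicator has average
  \<open>e\<close> over all rotations \<open>s\<close>.\<close>

lemma integral_rotation_overlap:
  assumes "0 \<le> d" "d \<le> 1" "0 \<le> e" "e \<le> 1"
  shows "(\<integral>s. rotation_overlap d e (cis (2 * pi * s)) \<partial>unit_lebesgue) = d * e"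
proof -
  have I: "integrable unit_square (\<lambda>(s, y). indicat_real {..<d} y * indicat_real {..<e} (frac (y + s)))"
    unfolding split_beta'
    by (intro unit_square.integrable_const_bound[where B = 1]) (simp add: indicator_def, measurable)
  have "(\<integral>s. rotation_overlap d e (cis (2 * pi * s)) \<partial>unit_lebesgue)
      = (\<integral>s. (\<integral>y. indicat_real {..<d} y * indicat_real {..<e} (frac (y + s)) \<partial>unit_lebesgue) \<partial>unit_lebesgue)"
    unfolding rotation_overlap_cis ..
  also have "\<dots> = (\<integral>y. (\<integral>s. indicat_real {..<d} y * indicat_real {..<e} (frac (y + s)) \<partial>unit_lebesgue) \<partial>unit_lebesgue)"
    using unit_square.Fubini_integral[OF I] by simp
  also have "\<dots> = (\<integral>y. indicat_real {..<d} y * e \<partial>unit_lebesgue)"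
  proof (intro Bochner_Integration.integral_cong refl)
    fix y :: real
    have ind: "integrable unit_lebesgue (indicat_real {..<e})"
      by (rule integrable_unit_lebesgue_bounded[where B = 1]) (auto simp: indicator_def)
    have "(\<integral>s. indicat_real {..<e} (frac (y + s)) \<partial>unit_lebesgue) = e"
      using integral_rotate[OF ind, of y] measure_unit_lebesgue_lessThan[of e] assms
      by (simp add: add.commute)
    then show "(\<integral>s. indicat_real {..<d} y * indicat_real {..<e} (frac (y + s)) \<partial>unit_lebesgue) = indicat_real {..<d} y * e"
      by simp
  qed
  also have "\<dots> = d * e"
    using measure_unit_lebesgue_lessThan[of d] assms by simp
  finally show ?thesis .
qed

text \<open>Integrating over the fibre first turns the second coordinate into
  \<open>rotation_overlap\<close> at the Birkhoff sum, which leaves a correlation over the doubling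
  map with a continuous function on the circle.\<close>

lemma corner_rectangle_correlation_tendsto:
  assumes c: "c > 0" and A: "A \<in> corner_rectangles" and B: "B \<in> corner_rectangles"
  shows "(\<lambda>n. measure unit_square ((skew c ^^ n) -` A \<inter> B)) \<longlonglongrightarrow> measure unit_square A * measure unit_square B"
proof -
  obtain a e where A_eq: "A = {0..<a} \<times> {0..<e}" and a: "0 \<le> a" "a \<le> 1" and e: "0 \<le> e" "e \<le> 1"
    using A by (auto simp: corner_rectangles_def)
  obtain b d where B_eq: "B = {0..<b} \<times> {0..<d}" and b: "0 \<le> b" "b \<le> 1" and d: "0 \<le> d" "d \<le> 1"
    using B by (auto simp: corner_rectangles_def)
  have measure_rect: "measure unit_square ({0..<p} \<times> {0..<q}) = p * q"
    if "0 \<le> p" "p \<le> 1" "0 \<le> q" "q \<le> 1" for p q :: real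
  proof -
    have "emeasure unit_square ({0..<p} \<times> {0..<q}) = emeasure unit_lebesgue {0..<p} * emeasure unit_lebesgue {0..<q}"
      using that by (intro unit_lebesgue.emeasure_pair_measure_Times) (auto simp: sets_unit_lebesgue_iff)
    then show ?thesis
      using that by (simp add: emeasure_unit_lebesgue sets_unit_lebesgue_iff measure_def ennreal_mult[symmetric])
  qed
  have "measure unit_square ((skew c ^^ n) -` A \<inter> B) =
      (\<integral>x. indicator {0..<a} ((doubling ^^ n) x) * rotation_overlap d e (cis (2 * pi * birkhoff c n x)) * indicator {..<b} x \<partial>unit_lebesgue)" for n
  proof -
    have "(skew c ^^ n) -` A \<inter> B = ((skew c ^^ n) -` A \<inter> space unit_square) \<inter> B"
      using sets.sets_into_space[OF corner_rectangles_sets[OF B]] by auto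
    also have "\<dots> \<in> sets unit_square"
      by (intro sets.Int measurable_sets[OF measurable_funpow[OF skew_measurable]] corner_rectangles_sets A B)
    finally have "measure unit_square ((skew c ^^ n) -` A \<inter> B) =
        (\<integral>x. (\<integral>y. indicator ((skew c ^^ n) -` A \<inter> B) (x, y) \<partial>unit_lebesgue) \<partial>unit_lebesgue)"
      by (rule measure_unit_square_sections)
    also have "\<dots> = (\<integral>x. (\<integral>y. (indicator {0..<a} ((doubling ^^ n) x) * indicator {..<b} x) *
        (indicator {..<d} y * indicator {..<e} (frac (y + birkhoff c n x))) \<partial>unit_lebesgue) \<partial>unit_lebesgue)"
      by (intro Bochner_Integration.integral_cong refl)
        (auto simp: A_eq B_eq skew_funpow indicator_def)
    also have "\<dots> = (\<integral>x. indicator {0..<a} ((doubling ^^ n) x) * rotation_overlap d e (cis (2 * pi * birkhoff c n x)) * indicator {..<b} x \<partial>unit_lebesgue)"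
      unfolding rotation_overlap_cis integral_mult_right_zero by (simp only: mult_ac)
    finally show ?thesis .
  qed
  moreover have "measure unit_lebesgue ({0..<a} \<inter> {0..<1}) = a"
    using a by (simp add: measure_def emeasure_unit_lebesgue sets_unit_lebesgue_iff Int_absorb2)
  then have "measure unit_lebesgue ({0..<a} \<inter> {0..<1}) * b * (\<integral>s. rotation_overlap d e (cis (2 * pi * s)) \<partial>unit_lebesgue)
      = measure unit_square A * measure unit_square B"
    using a b d e by (simp add: A_eq B_eq measure_rect integral_rotation_overlap)
  ultimately show ?thesis
    using circle_correlation_tendsto[OF c _ b rotation_overlap_continuous, of "{0..<a}" d e] by simp
qed

lemma mixing_skew:
  assumes "c > 0"
  shows "mixing unit_square (skew c)"
  unfolding mixing_def
proof (intro conjI ballI unit_square.prob_space_axioms measure_preserving_skew)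
  fix A B assume AB: "A \<in> sets unit_square" "B \<in> sets unit_square"
  have gen: "sets unit_square = sigma_sets (space unit_square) corner_rectangles"
    unfolding space_unit_square by (rule sets_unit_square_corner_rectangles)
  show "(\<lambda>n. measure unit_square ((skew c ^^ n) -` A \<inter> B)) \<longlonglongrightarrow> measure unit_square A * measure unit_square B"
    by (rule correlation_tendsto_sigma_sets[OF unit_square.prob_space_axioms measure_preserving_skew
          Int_stable_corner_rectangles gen corner_rectangle_correlation_tendsto[OF assms] AB])
qed

theorem theorem2:
  fixes c :: real and f :: "real \<times> real \<Rightarrow> real \<times> real"
  assumes "c > 0"
    and "f \<in> torus \<rightarrow> torus"
    and "\<And>x y. (x, y) \<in> torus \<Longrightarrow> x \<noteq> 1/2 \<Longrightarrow>
      f (x, y) = (2 * x - of_int \<lfloor>2 * x\<rfloor>,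
                  y + c / \<bar>x - 1/2\<bar> - of_int \<lfloor>y + c / \<bar>x - 1/2\<bar>\<rfloor>)"
  shows "measure_preserving torus_lebesgue f \<and>
         (c > 1/4 \<longrightarrow> mixing torus_lebesgue f)"
proof -
  \<comment> \<open>On the circle \<open>x = 1/2\<close> the values of \<open>f\<close> in
    \<open>torus\<close> are arbitrary; the circle is a null set, so \<open>f\<close> agrees almost
    everywhere with \<open>skew c\<close>.\<close>
  have "{1/2} \<times> {0..<1} \<in> null_sets unit_square"
    by (auto simp: null_sets_def sets_unit_lebesgue_iff unit_lebesgue.emeasure_pair_measure_Times emeasure_unit_lebesgue)
  moreover have "{p \<in> space unit_square. f p \<noteq> skew c p} \<subseteq> {1/2} \<times> {0..<1}"
  proof
    fix p assume p: "p \<in> {p \<in> space unit_square. f p \<noteq> skew c p}"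
    obtain x y where xy: "p = (x, y)" by (cases p)
    have "x = 1/2"
    proof (rule ccontr)
      assume "x \<noteq> 1/2"
      then have "f (x, y) = skew c (x, y)"
        using p xy assms(3)[of x y] by (simp add: skew_def doubling_def roof_def frac_def)
      then show False using p xy by simp
    qed
    then show "p \<in> {1/2} \<times> {0..<1}"
      using p xy by (simp add: torus_def)
  qed
  ultimately have eq: "AE p in unit_square. f p = skew c p"
    by (rule AE_I')
  have f: "f \<in> space unit_square \<rightarrow> space unit_square"
    using assms(2) by simp
  have "mixing torus_lebesgue f"
    unfolding torus_lebesgue_eq by (rule mixing_completion[OF mixing_skew[OF assms(1)] eq f])
  then show ?thesis
    by (simp add: mixing_def)
qed

end
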